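(* If $G$ is a subcubic graph of order $n$ with no isolated vertex, then $i(G) \le \frac{1}{2}n$. Further, if $G$ is connected, then $i(G)=\frac{1}{2}n$ if and only if one of the following holds: (a) $G \in \{G_1,G_2,G_3,G_4,G_5\}$; (b) $n=2k$ for some $k\ge 1$ and $G=\mathrm{cor}(P_k)$; (c) $n=2k$ for some $k\ge 3$ and $G=\mathrm{cor}(C_k)$.
   Context: A subcubic graph is a graph of maximum degree at most $3$. $i(G)$ is the minimum cardinality of an independent set $S$ of vertices such that every vertex not in $S$ is adjacent to a vertex of $S$. $P_k$ and $C_k$ are the path and cycle on $k$ vertices; $\mathrm{cor}(F)$ is the graph obtained from $F$ by adding a pendant edge (a new leaf) at each vertex of $F$. $G_1=K_{2,2}$; $G_2=K_{3,3}$; $G_3$ is obtained from $K_{2,3}$ by adding a new vertex adjacent to exactly one vertex of the part of size $3$; $G_4$ is the double star $S(2,2)$ (two adjacent vertices, each adjacent to two further leaves); $G_5$ is obtained from the path $a_1a_2a_3a_4a_5a_6$ by adding the edge $a_2a_5$. *)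

theory Defs
  imports "Graph_Theory.Graph_Theory"
begin

text \<open>
  A finite simple graph is a symmetric digraph in the sense of the locale \<open>graph\<close>: each
  undirected edge is a pair of opposite arcs, so the degree of a vertex is its out-degree.
\<close>

definition subcubic :: "('a, 'b) pre_digraph \<Rightarrow> bool" where
  "subcubic G \<longleftrightarrow> (\<forall>v \<in> verts G. out_degree G v \<le> 3)"

definition isolated_vertex :: "('a, 'b) pre_digraph \<Rightarrow> 'a \<Rightarrow> bool" where
  "isolated_vertex G v \<longleftrightarrow> v \<in> verts G \<and> out_degree G v = 0"

definition independent_set :: "('a, 'b) pre_digraph \<Rightarrow> 'a set \<Rightarrow> bool" where
  "independent_set G S \<longleftrightarrow> S \<subseteq> verts G \<and> (\<forall>u \<in> S. \<forall>v \<in> S. \<not> u \<rightarrow>\<^bsub>G\<^esub> v)"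

definition dominating_set :: "('a, 'b) pre_digraph \<Rightarrow> 'a set \<Rightarrow> bool" where
  "dominating_set G S \<longleftrightarrow> S \<subseteq> verts G \<and> (\<forall>v \<in> verts G - S. \<exists>u \<in> S. v \<rightarrow>\<^bsub>G\<^esub> u)"

definition indep_dom_number :: "('a, 'b) pre_digraph \<Rightarrow> nat" where
  "indep_dom_number G = (LEAST k. \<exists>S. independent_set G S \<and> dominating_set G S \<and> card S = k)"

definition graph_of_edges :: "'a set \<Rightarrow> ('a \<times> 'a) set \<Rightarrow> 'a pair_pre_digraph" where
  "graph_of_edges V E = \<lparr> pverts = V, parcs = E \<union> E\<inverse> \<rparr>"

text \<open>The end points of the new edge are added as vertices if they are not yet present.\<close>

definition add_edge :: "'a \<Rightarrow> 'a \<Rightarrow> 'a pair_pre_digraph \<Rightarrow> 'a pair_pre_digraph" where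
  "add_edge u v F = \<lparr> pverts = pverts F \<union> {u, v}, parcs = parcs F \<union> {(u, v), (v, u)} \<rparr>"

definition path_graph :: "nat \<Rightarrow> nat pair_pre_digraph" where
  "path_graph k = graph_of_edges {..<k} {(i, i + 1) | i. i + 1 < k}"

text \<open>Only meant for \<open>k \<ge> 3\<close>.\<close>

definition cycle_graph :: "nat \<Rightarrow> nat pair_pre_digraph" where
  "cycle_graph k = graph_of_edges {..<k} {(i, (i + 1) mod k) | i. i < k}"

definition complete_bipartite_graph :: "nat \<Rightarrow> nat \<Rightarrow> nat pair_pre_digraph" where
  "complete_bipartite_graph r s = graph_of_edges {..<r + s} ({..<r} \<times> {r..<r + s})"

text \<open>The vertices of \<open>F\<close> are the \<open>Inl v\<close>; \<open>Inr v\<close> is the new leaf attached at \<open>v\<close>.\<close>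

definition cor :: "'a pair_pre_digraph \<Rightarrow> ('a + 'a) pair_pre_digraph" where
  "cor F = \<lparr> pverts = pverts F <+> pverts F,
     parcs = {(Inl u, Inl v) | u v. (u, v) \<in> parcs F}
           \<union> {(Inl v, Inr v) | v. v \<in> pverts F} \<union> {(Inr v, Inl v) | v. v \<in> pverts F} \<rparr>"

definition G\<^sub>1 :: "nat pair_pre_digraph" where
  "G\<^sub>1 = complete_bipartite_graph 2 2"

definition G\<^sub>2 :: "nat pair_pre_digraph" where
  "G\<^sub>2 = complete_bipartite_graph 3 3"

text \<open>The parts of \<open>complete_bipartite_graph 2 3\<close> are \<open>{0, 1}\<close> and \<open>{2, 3, 4}\<close>.\<close>

definition G\<^sub>3 :: "nat pair_pre_digraph" where
  "G\<^sub>3 = add_edge 2 5 (complete_bipartite_graph 2 3)"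

definition G\<^sub>4 :: "nat pair_pre_digraph" where
  "G\<^sub>4 = graph_of_edges {..<6} {(0, 1), (0, 2), (0, 3), (1, 4), (1, 5)}"

text \<open>The vertices \<open>a\<^sub>1, \<dots>, a\<^sub>6\<close> of the path are numbered \<open>0, \<dots>, 5\<close>.\<close>

definition G\<^sub>5 :: "nat pair_pre_digraph" where
  "G\<^sub>5 = add_edge 1 4 (path_graph 6)"

lemma complete_bipartite_graph: "K\<^bsub>r,s\<^esub> (with_proj (complete_bipartite_graph r s))"
proof -
  let ?F = "complete_bipartite_graph r s"
  have "pverts ?F = {..<r} \<union> {r..<r + s}" "{..<r} \<inter> {r..<r + s} = {}"
    "card {..<r} = r" "card {r..<r + s} = s"
    "parcs ?F = {..<r} \<times> {r..<r + s} \<union> {r..<r + s} \<times> {..<r}"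
    by (auto simp: complete_bipartite_graph_def graph_of_edges_def)
  moreover from this have "finite (pverts ?F)"
    by simp
  ultimately show ?thesis
    unfolding complete_bipartite_digraph_pair_def by blast
qed

lemma pair_graphI:
  assumes "finite (pverts F)" and sub: "parcs F \<subseteq> pverts F \<times> pverts F"
    and "sym (parcs F)" and "\<And>v. (v, v) \<notin> parcs F"
  shows "pair_graph F"
proof -
  have "finite (parcs F)"
    by (rule finite_subset[OF sub]) (simp add: assms(1))
  then show ?thesis
    using assms by unfold_locales (auto simp: symmetric_def)
qed

lemma pair_graph_path_graph: "pair_graph (path_graph k)"
  by (rule pair_graphI) (auto simp: path_graph_def graph_of_edges_def sym_def)

lemma pair_graph_cycle_graph:
  assumes "k \<ge> 3"
  shows "pair_graph (cycle_graph k)"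
proof (rule pair_graphI)
  have "Suc i mod k \<noteq> i" if "i < k" for i
    using assms that by (cases "Suc i = k") auto
  then show "(v, v) \<notin> parcs (cycle_graph k)" for v
    by (force simp: cycle_graph_def graph_of_edges_def)
qed (use assms in \<open>auto simp: cycle_graph_def graph_of_edges_def intro: sym_Un_converse\<close>)

lemma pair_graph_cor:
  assumes "pair_graph F"
  shows "pair_graph (cor F)"
proof -
  interpret F: pair_graph F by fact
  have "sym (parcs F)"
    using F.pair_sym_arcs by (simp add: symmetric_def)
  show ?thesis
  proof (rule pair_graphI)
    show "sym (parcs (cor F))"
      using \<open>sym (parcs F)\<close> unfolding sym_def cor_def by auto
    show "(v, v) \<notin> parcs (cor F)" for v
      using F.no_loops' by (auto simp: cor_def)
  qed (auto simp: cor_def dest: F.in_arcsD1 F.in_arcsD2)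
qed

lemma (in graph) indep_dom_set_exists:
  "\<exists>S. independent_set G S \<and> dominating_set G S"
proof -
  have "finite {S. independent_set G S}"
    by (rule finite_subset[of _ "Pow (verts G)"]) (auto simp: independent_set_def)
  moreover have "{S. independent_set G S} \<noteq> {}"
    by (auto simp: independent_set_def)
  ultimately obtain S where S: "independent_set G S"
    and max: "\<And>T. independent_set G T \<Longrightarrow> S \<subseteq> T \<Longrightarrow> S = T"
    using finite_has_maximal[of "{S. independent_set G S}"] by auto
  have "\<exists>u \<in> S. v \<rightarrow>\<^bsub>G\<^esub> u" if v: "v \<in> verts G" "v \<notin> S" for v
  proof (rule ccontr)
    assume no: "\<not> ?thesis"
    have "\<not> v \<rightarrow>\<^bsub>G\<^esub> v"
      using adj_not_same by blast
    moreover have "\<not> u \<rightarrow>\<^bsub>G\<^esub> v" if "u \<in> S" for u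
      using no that sym_arcs by (auto simp: symmetric_def dest: symD)
    ultimately have "independent_set G (insert v S)"
      using S no v by (auto simp: independent_set_def)
    then show False
      using max[of "insert v S"] v by blast
  qed
  then show ?thesis
    using S by (auto simp: dominating_set_def independent_set_def)
qed

end

theory Submission
  imports Defs
begin

text \<open>
  Call \<open>w \<noteq> v\<close> a subtwin of \<open>v\<close> if \<open>\<emptyset> \<noteq> N(w) \<subseteq> N(v)\<close>; the subtwins of \<open>v\<close> are the vertices that become
  isolated when the closed neighbourhood \<open>N[v]\<close> is deleted. Adding \<open>v\<close> to an independent dominating
  set of \<open>G - N[v]\<close> gives one of \<open>G\<close>. A non-isolated vertex of minimum degree, or one of its
  neighbours, has fewer subtwins than neighbours, and deleting its closed neighbourhood proves
  \<open>2 i(G) \<le> n + n\<^sub>0\<close> by induction, where \<open>n\<^sub>0\<close> counts the isolated vertices.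

  If \<open>n\<^sub>0 = 0\<close> and \<open>2 i(G) = n\<close>, this bound for \<open>G - N[v]\<close> shows that every vertex \<open>v\<close> has at least
  \<open>deg v - 1\<close> subtwins. For connected \<open>G\<close> this local condition alone already forces \<open>G\<close> to be one of the
  listed graphs: without leaves \<open>G\<close> is \<open>G\<^sub>1\<close> or \<open>G\<^sub>2\<close>; two leaves at one vertex give \<open>G\<^sub>4\<close>; a vertex that
  is neither a leaf nor adjacent to one gives \<open>G\<^sub>3\<close> or \<open>G\<^sub>5\<close>; and otherwise \<open>G\<close> is the corona of a
  connected graph of maximum degree at most 2, that is, of a path or a cycle.
\<close>

section \<open>The upper bound\<close>

text \<open>A vertex set with an adjacency relation stands in for the digraph: deleting vertices
  merely restricts both, and the induction can run over all such pairs.\<close>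

locale subcubic_rel =
  fixes V :: "'a set" and E :: "'a \<Rightarrow> 'a \<Rightarrow> bool"
  assumes finite_V: "finite V"
    and E_in: "E u v \<Longrightarrow> u \<in> V"
    and E_sym: "E u v \<Longrightarrow> E v u"
    and E_irrefl: "\<not> E v v"
    and card_nbs: "card {w. E v w} \<le> 3"
begin

definition nbs :: "'a \<Rightarrow> 'a set" where
  "nbs v = {w. E v w}"

definition isolated :: "'a set" where
  "isolated = {v \<in> V. nbs v = {}}"

text \<open>The vertices that become isolated when \<open>v\<close> and its neighbours are deleted.\<close>

definition subtwins :: "'a \<Rightarrow> 'a set" where
  "subtwins v = {w. w \<noteq> v \<and> nbs w \<noteq> {} \<and> nbs w \<subseteq> nbs v}"

definition indep_dom :: "'a set \<Rightarrow> bool" where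
  "indep_dom S \<longleftrightarrow> S \<subseteq> V \<and> (\<forall>u \<in> S. \<forall>v \<in> S. \<not> E u v) \<and> (\<forall>v \<in> V - S. \<exists>u \<in> S. E v u)"

lemma in_nbs_sym: "w \<in> nbs v \<Longrightarrow> v \<in> nbs w"
  using E_sym by (auto simp: nbs_def)

lemma not_in_nbs_self [simp]: "v \<notin> nbs v"
  using E_irrefl by (auto simp: nbs_def)

lemma nbs_subset: "nbs v \<subseteq> V"
  using E_in E_sym by (auto simp: nbs_def)

lemma nbs_nonempty_in: "nbs v \<noteq> {} \<Longrightarrow> v \<in> V"
  using E_in by (auto simp: nbs_def)

lemma finite_nbs [simp]: "finite (nbs v)"
  using nbs_subset finite_V by (rule finite_subset)

lemma card_nbs_le: "card (nbs v) \<le> 3"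
  using card_nbs by (simp add: nbs_def)

lemma subtwins_subset: "subtwins v \<subseteq> V"
  using nbs_nonempty_in by (auto simp: subtwins_def)

lemma finite_subtwins [simp]: "finite (subtwins v)"
  using subtwins_subset finite_V by (rule finite_subset)

lemma subtwins_not_nbs: "w \<in> subtwins v \<Longrightarrow> w \<notin> nbs v"
  using in_nbs_sym by (force simp: subtwins_def)

text \<open>Suppose the opposite and let \<open>v\<close> be a non-isolated vertex of minimum
  degree. By minimality all its subtwins have the neighbourhood \<open>nbs v\<close>, so
  \<open>v\<close> and its subtwins form a set \<open>?T\<close> of at least deg v + 1 vertices, all
  adjacent to every neighbour \<open>a\<close> of \<open>v\<close>. As deg a \<le> 3, the degree of
  \<open>v\<close> is 1 or 2, and in both cases \<open>a\<close> turns out to have too few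
  subtwins.\<close>

lemma exists_few_subtwins:
  assumes "E x y"
  shows "\<exists>v. nbs v \<noteq> {} \<and> card (subtwins v) < card (nbs v)"
proof (rule ccontr)
  assume "\<not> ?thesis"
  then have many: "card (nbs v) \<le> card (subtwins v)" if "nbs v \<noteq> {}" for v
    using that by (meson not_le)
  have "\<exists>v. nbs v \<noteq> {}"
    using assms by (auto simp: nbs_def)
  then obtain v where v: "nbs v \<noteq> {}" "\<And>w. nbs w \<noteq> {} \<Longrightarrow> card (nbs v) \<le> card (nbs w)"
    using ex_has_least_nat[of "\<lambda>v. nbs v \<noteq> {}" _ "\<lambda>v. card (nbs v)"] by blast
  have twin: "nbs w = nbs v" if "w \<in> subtwins v" for w
    using that v(2)[of w] by (intro card_seteq) (auto simp: subtwins_def)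
  obtain a where a: "a \<in> nbs v"
    using v(1) by auto
  let ?T = "insert v (subtwins v)"
  have T_sub: "?T \<subseteq> nbs b" if "b \<in> nbs v" for b
    using that twin in_nbs_sym by auto
  have v_notin: "v \<notin> subtwins v"
    by (simp add: subtwins_def)
  have card_T: "card ?T = card (subtwins v) + 1"
    using v_notin by simp
  show False
  proof (cases "card (nbs v) = 1")
    case True
    then have nv: "nbs v = {a}"
      using a by (auto simp: card_1_singleton_iff)
    have "card (subtwins v) \<ge> 1"
      using many[OF v(1)] True by simp
    then obtain w where w: "w \<in> subtwins v"
      by (metis card.empty equals0I not_one_le_zero)
    have nw: "nbs w = {a}" and wv: "w \<noteq> v"
      using twin[OF w] nv w by (auto simp: subtwins_def)
    have vw: "{v, w} \<subseteq> nbs a"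
      using nv nw in_nbs_sym by auto
    have ne: "v \<notin> nbs z" "w \<notin> nbs z" if "z \<noteq> a" for z
      using nv nw in_nbs_sym that by blast+
    have nz: "nbs z \<subseteq> nbs a - {v, w}" if "z \<in> subtwins a" for z
      using that ne[of z] by (auto simp: subtwins_def)
    have a_many: "card (nbs a) \<le> card (subtwins a)"
      using many[of a] vw by auto
    have "card (nbs a - {v, w}) = card (nbs a) - 2"
      using vw wv by (subst card_Diff_subset) auto
    then have "card (nbs a - {v, w}) \<le> 1"
      using card_nbs_le[of a] by simp
    then have "card (nbs a - {v, w}) = 0 \<or> card (nbs a - {v, w}) = 1"
      by linarith
    then consider "nbs a - {v, w} = {}" | c where "nbs a - {v, w} = {c}"
      by (metis card_0_eq card_1_singletonE finite_Diff finite_nbs)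
    then show False
    proof cases
      case 1
      then have "subtwins a = {}"
        using nz by (force simp: subtwins_def)
      then show False
        using a_many vw by (auto simp: card_eq_0_iff)
    next
      case 2
      \<comment> \<open>The leaves \<open>v\<close> and \<open>w\<close> are adjacent to
        \<open>a\<close> alone, so a subtwin of \<open>a\<close> has \<open>c\<close> as its only
        neighbour. Since \<open>a\<close> takes one of the three places at \<open>c\<close>, at most
        two subtwins remain.\<close>
      have "subtwins a \<subseteq> nbs c - {a}"
        using nz 2 in_nbs_sym by (fastforce simp: subtwins_def)
      then have "card (subtwins a) \<le> card (nbs c - {a})"
        by (intro card_mono) auto
      also have "a \<in> nbs c"
        using 2 in_nbs_sym by auto
      then have "card (nbs c - {a}) \<le> 2"
        using card_nbs_le[of c] by simp
      finally have "card (subtwins a) \<le> 2" .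
      have "nbs a = {v, w, c}"
        using 2 vw by auto
      moreover have "c \<noteq> v" "c \<noteq> w"
        using 2 by blast+
      ultimately have "card (nbs a) = 3"
        using wv by simp
      then show False
        using a_many \<open>card (subtwins a) \<le> 2\<close> by simp
    qed
  next
    case False
    have "card ?T \<le> card (nbs a)"
      using T_sub[OF a] by (intro card_mono) auto
    moreover have "card (nbs v) \<noteq> 0"
      using v(1) by (simp add: card_eq_0_iff)
    \<comment> \<open>deg v + 1 \<le> card \<open>?T\<close> \<le> deg a \<le> 3, and deg v is
      neither 0 nor 1.\<close>
    ultimately have c2: "card (nbs v) = 2" and c3: "card ?T = 3"
      using card_T many[OF v(1)] card_nbs_le[of a] False by linarith+
    obtain b where b: "nbs v = {a, b}" "a \<noteq> b"
    proof -
      obtain p q where "nbs v = {p, q}" "p \<noteq> q"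
        using c2 unfolding card_2_iff by blast
      then have "nbs v = {a, if a = p then q else p}" "a \<noteq> (if a = p then q else p)"
        using a by auto
      then show ?thesis
        by (rule that)
    qed
    have na: "nbs a = ?T"
      using T_sub[OF a] c3 card_nbs_le[of a] by (intro card_seteq[symmetric]) auto
    \<comment> \<open>Every vertex of \<open>?T\<close>, the neighbourhood of \<open>a\<close>, has
      neighbourhood {a, b}; hence a vertex adjacent to one of them is \<open>a\<close> or
      \<open>b\<close>.\<close>
    have "subtwins a \<subseteq> {b}"
    proof
      fix z assume z: "z \<in> subtwins a"
      then have "nbs z \<noteq> {}" "nbs z \<subseteq> ?T"
        unfolding na[symmetric] by (simp_all add: subtwins_def)
      then obtain t where "t \<in> nbs z" "t \<in> ?T"
        by blast
      then have "z \<in> {a, b}"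
        using in_nbs_sym twin b by blast
      then show "z \<in> {b}"
        using z by (auto simp: subtwins_def)
    qed
    then have "card (subtwins a) \<le> 1"
      using card_mono[of "{b}"] by auto
    moreover have "card (nbs a) = 3"
      using na c3 by simp
    ultimately show False
      using many[of a] by fastforce
  qed
qed

section \<open>Deleting a closed neighbourhood\<close>

definition del_nbhd_V :: "'a \<Rightarrow> 'a set" where
  "del_nbhd_V v = V - insert v (nbs v)"

definition del_nbhd_E :: "'a \<Rightarrow> 'a \<Rightarrow> 'a \<Rightarrow> bool" where
  "del_nbhd_E v x y \<longleftrightarrow> E x y \<and> x \<in> del_nbhd_V v \<and> y \<in> del_nbhd_V v"

lemma subcubic_rel_del_nbhd: "subcubic_rel (del_nbhd_V v) (del_nbhd_E v)"
proof
  show "card {w. del_nbhd_E v u w} \<le> 3" for u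
  proof -
    have "card {w. del_nbhd_E v u w} \<le> card (nbs u)"
      by (rule card_mono) (auto simp: del_nbhd_E_def nbs_def[symmetric], simp add: nbs_def)
    then show ?thesis
      using card_nbs_le[of u] by simp
  qed
qed (auto simp: del_nbhd_E_def E_irrefl E_sym, simp add: del_nbhd_V_def finite_V)

lemma card_del_nbhd:
  assumes "v \<in> V"
  shows "card V = card (del_nbhd_V v) + card (nbs v) + 1"
proof -
  have sub: "insert v (nbs v) \<subseteq> V"
    using assms nbs_subset by auto
  have "card V = card (V - insert v (nbs v)) + card (insert v (nbs v))"
    using card_Diff_subset[OF _ sub] card_mono[OF finite_V sub] by simp
  then show ?thesis
    by (simp add: del_nbhd_V_def)
qed

text \<open>A surviving vertex is not adjacent to \<open>v\<close>, so if all its neighbours are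
  deleted, they lie in \<open>nbs v\<close>.\<close>

lemma isolated_del_nbhd:
  "subcubic_rel.isolated (del_nbhd_V v) (del_nbhd_E v) \<subseteq> isolated \<union> subtwins v"
proof
  interpret D: subcubic_rel "del_nbhd_V v" "del_nbhd_E v"
    by (rule subcubic_rel_del_nbhd)
  fix w assume w: "w \<in> D.isolated"
  then have "w \<in> del_nbhd_V v"
    by (simp add: D.isolated_def)
  then have wV: "w \<in> V" "w \<noteq> v" "w \<notin> nbs v"
    by (auto simp: del_nbhd_V_def)
  have "nbs w \<subseteq> nbs v"
  proof
    fix y assume y: "y \<in> nbs w"
    then have "y \<noteq> v"
      using wV in_nbs_sym by blast
    moreover have "\<not> del_nbhd_E v w y"
      using w by (auto simp: D.isolated_def D.nbs_def)
    ultimately show "y \<in> nbs v"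
      using y wV nbs_subset by (auto simp: del_nbhd_E_def del_nbhd_V_def nbs_def)
  qed
  then show "w \<in> isolated \<union> subtwins v"
    using wV by (auto simp: isolated_def subtwins_def)
qed

text \<open>\<open>v\<close> dominates its neighbours and is adjacent to nothing in
  \<open>S\<close>. The last two claims serve to count \<open>insert v S\<close> as exactly one
  vertex more than \<open>S\<close>.\<close>

lemma indep_dom_insert:
  assumes "v \<in> V" "subcubic_rel.indep_dom (del_nbhd_V v) (del_nbhd_E v) S"
  shows "indep_dom (insert v S)" "v \<notin> S" "finite S"
proof -
  interpret D: subcubic_rel "del_nbhd_V v" "del_nbhd_E v"
    by (rule subcubic_rel_del_nbhd)
  have S: "S \<subseteq> del_nbhd_V v"
    using assms by (simp add: D.indep_dom_def)
  then show "v \<notin> S" "finite S"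
    using D.finite_V by (auto simp: del_nbhd_V_def intro: finite_subset)
  show "indep_dom (insert v S)"
    unfolding indep_dom_def
  proof (intro conjI ballI)
    show "insert v S \<subseteq> V"
      using S assms by (auto simp: del_nbhd_V_def)
    have "\<not> E v s" "\<not> E s v" if "s \<in> S" for s
      using that S E_sym[of s v] by (auto simp: del_nbhd_V_def nbs_def)
    moreover have "\<not> E s t" if "s \<in> S" "t \<in> S" for s t
      using that S assms(2) by (auto simp: D.indep_dom_def del_nbhd_E_def)
    moreover fix x y assume "x \<in> insert v S" "y \<in> insert v S"
    ultimately show "\<not> E x y"
      using E_irrefl by blast
  next
    fix x assume "x \<in> V - insert v S"
    then have "x \<in> nbs v \<or> x \<in> del_nbhd_V v - S"
      by (auto simp: del_nbhd_V_def)
    then show "\<exists>u \<in> insert v S. E x u"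
      using assms(2) E_sym by (auto simp: D.indep_dom_def del_nbhd_E_def nbs_def)
  qed
qed

end

text \<open>The isolated vertices enter the bound because deletion creates new ones. With
  \<open>v\<close> from \<open>exists_few_subtwins\<close>, deleting its closed neighbourhood
  removes deg v + 1 vertices and creates at most deg v - 1 isolated ones, so the right-hand side
  drops by at least 2, which pays for putting \<open>v\<close> into the set.\<close>

lemma indep_dom_bound:
  assumes "subcubic_rel V E"
  shows "\<exists>S. subcubic_rel.indep_dom V E S \<and>
    2 * card S \<le> card V + card (subcubic_rel.isolated V E)"
  using assms
proof (induction "card V" arbitrary: V E rule: less_induct)
  case less
  interpret subcubic_rel V E by fact
  show ?case
  proof (cases "\<exists>x y. E x y")
    case False
    then have "isolated = V" "indep_dom V"
      by (auto simp: isolated_def nbs_def indep_dom_def)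
    then show ?thesis
      by (intro exI[of _ V]) auto
  next
    case True
    then obtain v where v: "nbs v \<noteq> {}" "card (subtwins v) < card (nbs v)"
      using exists_few_subtwins by blast
    have vV: "v \<in> V"
      using v(1) by (rule nbs_nonempty_in)
    interpret D: subcubic_rel "del_nbhd_V v" "del_nbhd_E v"
      by (rule subcubic_rel_del_nbhd)
    obtain S where S: "D.indep_dom S" "2 * card S \<le> card (del_nbhd_V v) + card D.isolated"
      using less.hyps[of "del_nbhd_V v" "del_nbhd_E v"] card_del_nbhd[OF vV] D.subcubic_rel_axioms
      by auto
    have "card D.isolated \<le> card (isolated \<union> subtwins v)"
      using isolated_del_nbhd finite_V by (intro card_mono) (auto simp: isolated_def)
    also have "\<dots> \<le> card isolated + card (subtwins v)"
      by (rule card_Un_le)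
    finally show ?thesis
      using S(2) v(2) card_del_nbhd[OF vV] indep_dom_insert[OF vV S(1)]
      by (intro exI[of _ "insert v S"]) auto
  qed
qed

text \<open>Adding \<open>v\<close> to a set \<open>S\<close> for the remaining graph gives card V
  \<le> 2 * card S + 2, while the bound there gives 2 * card S \<le> card V - deg v - 1 + card
  (subtwins v). Comparing the two yields the claim.\<close>

lemma (in subcubic_rel) extremal_subtwins:
  assumes "isolated = {}" "\<And>S. indep_dom S \<Longrightarrow> card V \<le> 2 * card S" "v \<in> V"
  shows "card (nbs v) \<le> card (subtwins v) + 1"
proof -
  interpret D: subcubic_rel "del_nbhd_V v" "del_nbhd_E v"
    by (rule subcubic_rel_del_nbhd)
  obtain S where S: "D.indep_dom S" "2 * card S \<le> card (del_nbhd_V v) + card D.isolated"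
    using indep_dom_bound[OF D.subcubic_rel_axioms] by auto
  have "card D.isolated \<le> card (subtwins v)"
    using isolated_del_nbhd assms(1) by (intro card_mono) auto
  moreover have "card V \<le> 2 * (card S + 1)"
    using assms(2)[of "insert v S"] indep_dom_insert[OF assms(3) S(1)] by simp
  ultimately show ?thesis
    using S(2) card_del_nbhd[OF assms(3)] by simp
qed

section \<open>Copies of the extremal graphs\<close>

text \<open>An isomorphism on the level of vertices only; \<open>digraph_iso_iff_copy_of\<close>
  relates it to \<open>digraph_iso\<close>. The bijection starts from \<open>H\<close>, so for a
  graph on an initial segment of the naturals it amounts to a list of the vertices in
  \<open>V\<close>.\<close>

definition copy_of :: "'c pair_pre_digraph \<Rightarrow> 'a set \<Rightarrow> ('a \<Rightarrow> 'a \<Rightarrow> bool) \<Rightarrow> bool" where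
  "copy_of H V E \<longleftrightarrow> (\<exists>g. bij_betw g (pverts H) V \<and>
    (\<forall>i \<in> pverts H. \<forall>j \<in> pverts H. E (g i) (g j) \<longleftrightarrow> (i, j) \<in> parcs H))"

lemma copy_of_listI:
  assumes "distinct xs" "set xs = V" "pverts H = {..<length xs}"
    and "\<forall>i \<in> {..<length xs}. \<forall>j \<in> {..<length xs}. E (xs ! i) (xs ! j) \<longleftrightarrow> (i, j) \<in> parcs H"
  shows "copy_of H V E"
  unfolding copy_of_def
  using assms by (intro exI[of _ "(!) xs"]) (auto intro: bij_betw_nth)

section \<open>Paths and cycles\<close>

lemma pverts_path_graph [simp]: "pverts (path_graph k) = {..<k}"
  by (simp add: path_graph_def graph_of_edges_def)

lemma pverts_cycle_graph [simp]: "pverts (cycle_graph k) = {..<k}"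
  by (simp add: cycle_graph_def graph_of_edges_def)

lemma parcs_path_graph_iff:
  assumes "i < k" "j < k"
  shows "(i, j) \<in> parcs (path_graph k) \<longleftrightarrow> j = Suc i \<or> i = Suc j"
  using assms by (auto simp: path_graph_def graph_of_edges_def)

lemma parcs_cycle_graph_iff:
  assumes "i < k" "j < k" "k \<ge> 3"
  shows "(i, j) \<in> parcs (cycle_graph k) \<longleftrightarrow>
    j = Suc i \<or> i = Suc j \<or> i = 0 \<and> Suc j = k \<or> j = 0 \<and> Suc i = k"
proof -
  have suc_mod: "b = Suc a mod k \<longleftrightarrow> b = Suc a \<or> b = 0 \<and> Suc a = k" if "a < k" "b < k" for a b
    using that by (cases "Suc a = k") auto
  have "(i, j) \<in> parcs (cycle_graph k) \<longleftrightarrow> j = Suc i mod k \<or> i = Suc j mod k"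
    using assms by (auto simp: cycle_graph_def graph_of_edges_def)
  then show ?thesis
    using suc_mod[OF assms(1,2)] suc_mod[OF assms(2,1)] by auto
qed

text \<open>Serves to identify what is left of a corona without its leaves. Connectedness is
  expressed by closed sets, because the vertex set of a longest path is shown to be closed.\<close>

lemma connected_max_degree_2_path_or_cycle:
  fixes U :: "'a set" and F :: "'a \<Rightarrow> 'a \<Rightarrow> bool"
  assumes fin: "finite U" and "U \<noteq> {}"
    and F_in: "\<And>u v. F u v \<Longrightarrow> u \<in> U"
    and F_sym: "\<And>u v. F u v \<Longrightarrow> F v u"
    and F_irrefl: "\<And>v. \<not> F v v"
    and F_deg: "\<And>v. card {w. F v w} \<le> 2"
    and F_conn: "\<And>A. A \<subseteq> U \<Longrightarrow> A \<noteq> {} \<Longrightarrow> (\<And>x y. x \<in> A \<Longrightarrow> F x y \<Longrightarrow> y \<in> A) \<Longrightarrow> A = U"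
  shows "(\<exists>k \<ge> 1. copy_of (path_graph k) U F) \<or> (\<exists>k \<ge> 3. copy_of (cycle_graph k) U F)"
proof -
  have deg: "a = b \<or> a = c \<or> b = c" if "F v a" "F v b" "F v c" for v a b c
  proof (rule ccontr)
    assume "\<not> ?thesis"
    then have "card {a, b, c} = 3"
      by auto
    moreover have "card {a, b, c} \<le> card {w. F v w}"
      using that by (intro card_mono finite_subset[OF _ fin]) (auto intro: F_in F_sym)
    ultimately show False
      using F_deg[of v] by simp
  qed
  \<comment> \<open>A longest path exhausts \<open>U\<close>, and only its two ends can be joined by a further edge.\<close>
  define P where "P xs \<longleftrightarrow> distinct xs \<and> set xs \<subseteq> U \<and> xs \<noteq> [] \<and>
    (\<forall>i. Suc i < length xs \<longrightarrow> F (xs ! i) (xs ! Suc i))" for xs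
  obtain u where "u \<in> U"
    using \<open>U \<noteq> {}\<close> by auto
  then have "P [u]"
    by (simp add: P_def)
  moreover have "length xs < Suc (card U)" if "P xs" for xs
    using that fin card_mono[of U "set xs"] distinct_card[of xs] by (simp add: P_def)
  ultimately obtain xs where xs: "P xs" and longest: "\<And>ys. P ys \<Longrightarrow> length ys \<le> length xs"
    using ex_has_greatest_nat[of P "[u]" length "Suc (card U)"] by blast
  let ?k = "length xs"
  have k: "?k \<ge> 1" and dist: "distinct xs" and sub: "set xs \<subseteq> U"
    and step: "\<And>i. Suc i < ?k \<Longrightarrow> F (xs ! i) (xs ! Suc i)"
    using xs by (auto simp: P_def Suc_le_eq)
  have nth_inj: "xs ! i = xs ! j \<longleftrightarrow> i = j" if "i < ?k" "j < ?k" for i j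
    using that dist by (simp add: nth_eq_iff_index_eq)
  have two_nbs: "y = xs ! (i - 1) \<or> y = xs ! Suc i" if "0 < i" "Suc i < ?k" "F (xs ! i) y" for i y
  proof -
    have "F (xs ! i) (xs ! (i - 1))"
      using step[of "i - 1"] that by (auto intro: F_sym)
    moreover have "xs ! (i - 1) \<noteq> xs ! Suc i"
      using nth_inj[of "i - 1" "Suc i"] that by simp
    ultimately show ?thesis
      using deg that step by blast
  qed
  have "set xs = U"
  proof (rule F_conn[OF sub])
    show "set xs \<noteq> {}"
      using k by auto
    fix x y assume "x \<in> set xs" and xy: "F x y"
    then obtain i where i: "i < ?k" "x = xs ! i"
      by (auto simp: in_set_conv_nth)
    show "y \<in> set xs"
    proof (rule ccontr)
      assume y: "y \<notin> set xs"
      have yU: "y \<in> U"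
        using xy F_in F_sym by blast
      \<comment> \<open>An outside neighbour of an end would prolong the path, and an inner vertex
        already has its two neighbours on the path.\<close>
      consider "i = 0" | "Suc i = ?k" | "0 < i" "Suc i < ?k"
        using i by linarith
      then show False
      proof cases
        case 1
        have "P (y # xs)"
          unfolding P_def
        proof (intro conjI allI impI)
          fix j assume "Suc j < length (y # xs)"
          then show "F ((y # xs) ! j) ((y # xs) ! Suc j)"
            using xy i 1 step F_sym by (cases j) auto
        qed (use y yU dist sub in auto)
        then show False
          using longest[of "y # xs"] by simp
      next
        case 2
        have "P (xs @ [y])"
          unfolding P_def
        proof (intro conjI allI impI)
          fix j assume "Suc j < length (xs @ [y])"
          then consider "j = i" | "Suc j < ?k"
            using 2 by force
          then show "F ((xs @ [y]) ! j) ((xs @ [y]) ! Suc j)"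
            using xy i 2 step by cases (auto simp: nth_append)
        qed (use y yU dist sub in auto)
        then show False
          using longest[of "xs @ [y]"] by simp
      next
        case 3
        then show False
          using two_nbs[of i y] xy i y by auto
      qed
    qed
  qed
  have ends: "i = 0 \<and> Suc j = ?k" if "i < j" "j < ?k" "j \<noteq> Suc i" "F (xs ! i) (xs ! j)" for i j
  proof -
    have "i = 0"
      using two_nbs[of i "xs ! j"] nth_inj[of j "i - 1"] nth_inj[of j "Suc i"] that by force
    moreover have "Suc j = ?k"
      using two_nbs[of j "xs ! i"] nth_inj[of i "j - 1"] nth_inj[of i "Suc j"] that
        F_sym[OF that(4)] by force
    ultimately show ?thesis ..
  qed
  have adj: "F (xs ! i) (xs ! j) \<longleftrightarrow> j = Suc i \<or> i = Suc j \<or>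
      (i = 0 \<and> Suc j = ?k \<or> j = 0 \<and> Suc i = ?k) \<and> F (xs ! 0) (xs ! (?k - 1))"
    if ij: "i < ?k" "j < ?k" for i j
  proof -
    have one: "F (xs ! a) (xs ! b) \<longleftrightarrow>
        b = Suc a \<or> a = 0 \<and> Suc b = ?k \<and> F (xs ! 0) (xs ! (?k - 1))"
      if "a < b" "b < ?k" for a b
    proof (cases "a = 0 \<and> Suc b = ?k")
      case True
      then have "F (xs ! a) (xs ! b) \<longleftrightarrow> F (xs ! 0) (xs ! (?k - 1))"
        by (metis diff_Suc_1)
      then show ?thesis
        using True step[of a] that by blast
    next
      case False
      then show ?thesis
        using step[of a] ends[of a b] that by auto
    qed
    consider "i < j" | "i = j" | "j < i"
      by linarith
    then show ?thesis
    proof cases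
      case 1
      then show ?thesis
        using one[of i j] ij by auto
    next
      case 2
      then show ?thesis
        using F_irrefl ij by (cases "?k = 1") auto
    next
      case 3
      then show ?thesis
        using one[of j i] ij F_sym by (auto; metis)
    qed
  qed
  show ?thesis
  \<comment> \<open>On two vertices the ends are joined by the edge of the path itself, so a closing
    edge makes a cycle only from three vertices on.\<close>
  proof (cases "?k \<ge> 3 \<and> F (xs ! 0) (xs ! (?k - 1))")
    case True
    have "copy_of (cycle_graph ?k) U F"
      by (rule copy_of_listI[OF dist \<open>set xs = U\<close>])
        (use True in \<open>auto simp: adj parcs_cycle_graph_iff\<close>)
    then show ?thesis
      using True by blast
  next
    case False
    have "copy_of (path_graph ?k) U F"
    proof (rule copy_of_listI[OF dist \<open>set xs = U\<close>]; (intro ballI)?)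
      fix i j assume "i \<in> {..<?k}" "j \<in> {..<?k}"
      then have ij: "i < ?k" "j < ?k"
        by simp_all
      have "(i = 0 \<and> Suc j = ?k \<or> j = 0 \<and> Suc i = ?k) \<and> F (xs ! 0) (xs ! (?k - 1))
          \<Longrightarrow> j = Suc i \<or> i = Suc j"
        using False F_irrefl[of "xs ! 0"] ij by (cases "?k = 1"; cases "?k = 2") auto
      then show "F (xs ! i) (xs ! j) \<longleftrightarrow> (i, j) \<in> parcs (path_graph ?k)"
        using adj[OF ij] parcs_path_graph_iff[OF ij] by blast
    qed simp
    then show ?thesis
      using k by blast
  qed
qed

section \<open>Explicit vertices and arcs of coronas and of the five exceptional graphs\<close>

lemma pverts_cor: "pverts (cor H) = pverts H <+> pverts H"
  by (simp add: cor_def)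

lemma parcs_cor [simp]:
  "(Inl i, Inl j) \<in> parcs (cor H) \<longleftrightarrow> (i, j) \<in> parcs H"
  "(Inl i, Inr j) \<in> parcs (cor H) \<longleftrightarrow> i = j \<and> i \<in> pverts H"
  "(Inr i, Inl j) \<in> parcs (cor H) \<longleftrightarrow> i = j \<and> i \<in> pverts H"
  "(Inr i, Inr j) \<notin> parcs (cor H)"
  by (auto simp: cor_def)

lemma complete_bipartite_graph_simps:
  "pverts (complete_bipartite_graph r s) = {..<r + s}"
  "parcs (complete_bipartite_graph r s) = {..<r} \<times> {r..<r + s} \<union> {r..<r + s} \<times> {..<r}"
  by (auto simp: complete_bipartite_graph_def graph_of_edges_def)

lemma lessThan_4_6:
  "{..<4::nat} = {0, 1, 2, 3}"
  "{..<6::nat} = {0, 1, 2, 3, 4, 5}"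
  by auto

lemma G1_simps:
  "pverts G\<^sub>1 = {..<4}"
  "parcs G\<^sub>1 = {0, 1} \<times> {2, 3} \<union> {2, 3} \<times> {0, 1}"
proof -
  have *: "{..<2::nat} = {0, 1}" "{2..<2 + 2::nat} = {2, 3}"
    by auto
  show "pverts G\<^sub>1 = {..<4}" "parcs G\<^sub>1 = {0, 1} \<times> {2, 3} \<union> {2, 3} \<times> {0, 1}"
    unfolding G\<^sub>1_def complete_bipartite_graph_simps * by (simp, rule refl)
qed

lemma G2_simps:
  "pverts G\<^sub>2 = {..<6}"
  "parcs G\<^sub>2 = {0, 1, 2} \<times> {3, 4, 5} \<union> {3, 4, 5} \<times> {0, 1, 2}"
proof -
  have *: "{..<3::nat} = {0, 1, 2}" "{3..<3 + 3::nat} = {3, 4, 5}"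
    by auto
  show "pverts G\<^sub>2 = {..<6}"
    "parcs G\<^sub>2 = {0, 1, 2} \<times> {3, 4, 5} \<union> {3, 4, 5} \<times> {0, 1, 2}"
    unfolding G\<^sub>2_def complete_bipartite_graph_simps * by (simp, rule refl)
qed

lemma G3_simps:
  "pverts G\<^sub>3 = {..<6}"
  "parcs G\<^sub>3 = {0, 1} \<times> {2, 3, 4} \<union> {2, 3, 4} \<times> {0, 1} \<union> {(2, 5), (5, 2)}"
proof -
  have *: "{..<2::nat} = {0, 1}" "{2..<2 + 3::nat} = {2, 3, 4}"
    by auto
  show "parcs G\<^sub>3 = {0, 1} \<times> {2, 3, 4} \<union> {2, 3, 4} \<times> {0, 1} \<union> {(2, 5), (5, 2)}"
    unfolding G\<^sub>3_def add_edge_def complete_bipartite_graph_simps * by (simp only: pair_pre_digraph.simps)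
  show "pverts G\<^sub>3 = {..<6}"
    unfolding G\<^sub>3_def add_edge_def complete_bipartite_graph_simps by auto
qed

lemma G4_simps:
  "pverts G\<^sub>4 = {..<6}"
  "parcs G\<^sub>4 = {(0, 1), (0, 2), (0, 3), (1, 4), (1, 5), (1, 0), (2, 0), (3, 0), (4, 1), (5, 1)}"
  by (auto simp: G\<^sub>4_def graph_of_edges_def)

lemma G5_simps:
  "pverts G\<^sub>5 = {..<6}"
  "parcs G\<^sub>5 = {(0, 1), (1, 2), (2, 3), (3, 4), (4, 5), (1, 4),
    (1, 0), (2, 1), (3, 2), (4, 3), (5, 4), (4, 1)}"
proof -
  have "{(i, i + 1) |i. i + 1 < (6::nat)} = {(0, 1), (1, 2), (2, 3), (3, 4), (4, 5)}"
    by auto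
  then show "parcs G\<^sub>5 = {(0, 1), (1, 2), (2, 3), (3, 4), (4, 5), (1, 4),
    (1, 0), (2, 1), (3, 2), (4, 3), (5, 4), (4, 1)}"
    by (auto simp: G\<^sub>5_def path_graph_def graph_of_edges_def add_edge_def)
qed (auto simp: G\<^sub>5_def add_edge_def)

section \<open>Graphs in which every vertex has many subtwins\<close>

lemma two_distinct_elements:
  assumes "2 \<le> card A"
  obtains x y where "x \<in> A" "y \<in> A" "x \<noteq> y"
proof -
  obtain B where "B \<subseteq> A" "card B = 2"
    using assms obtain_subset_with_card_n by metis
  then show ?thesis
    using that by (auto simp: card_2_iff)
qed

text \<open>Domination enters only through \<open>tight\<close>, the local condition supplied by
  \<open>extremal_subtwins\<close>; \<open>conn\<close> is connectedness in terms of closed vertex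
  sets.\<close>

locale tight_graph = subcubic_rel +
  assumes nbs_nonempty: "v \<in> V \<Longrightarrow> nbs v \<noteq> {}"
    and tight: "v \<in> V \<Longrightarrow> card (nbs v) \<le> card (subtwins v) + 1"
    and V_nonempty: "V \<noteq> {}"
    and conn: "A \<subseteq> V \<Longrightarrow> A \<noteq> {} \<Longrightarrow> (\<And>x. x \<in> A \<Longrightarrow> nbs x \<subseteq> A) \<Longrightarrow> A = V"
begin

lemma E_iff: "E x y \<longleftrightarrow> y \<in> nbs x"
  by (simp add: nbs_def)

lemma nbs_in_V: "x \<in> nbs v \<Longrightarrow> v \<in> V" "x \<in> nbs v \<Longrightarrow> x \<in> V"
  using nbs_nonempty_in nbs_subset by blast+

lemma nbs_neq: "x \<in> nbs v \<Longrightarrow> v \<noteq> x"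
  by auto

lemma nbs_eq3:
  assumes "a \<in> nbs v" "b \<in> nbs v" "c \<in> nbs v" "a \<noteq> b" "a \<noteq> c" "b \<noteq> c"
  shows "nbs v = {a, b, c}"
proof -
  have "card {a, b, c} = 3"
    using assms by simp
  then show ?thesis
    using assms card_nbs_le[of v] by (intro card_seteq[symmetric]) auto
qed

lemma nbs_cases:
  assumes "a \<in> nbs v" "b \<in> nbs v" "a \<noteq> b"
  obtains "nbs v = {a, b}" | c where "nbs v = {a, b, c}" "c \<noteq> a" "c \<noteq> b"
proof (cases "nbs v \<subseteq> {a, b}")
  case True
  then show ?thesis
    using that(1) assms by blast
next
  case False
  then obtain c where "c \<in> nbs v" "c \<noteq> a" "c \<noteq> b"
    by auto
  then show ?thesis
    using nbs_eq3[of a v b c] assms that(2) by blast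
qed

lemma subtwinsD:
  assumes "z \<in> subtwins v"
  shows "z \<noteq> v" "nbs z \<noteq> {}" "nbs z \<subseteq> nbs v" "z \<notin> nbs v" "z \<in> V"
proof -
  show "z \<noteq> v" "nbs z \<noteq> {}" "nbs z \<subseteq> nbs v"
    using assms by (simp_all add: subtwins_def)
  show "z \<notin> nbs v"
    using assms by (rule subtwins_not_nbs)
  show "z \<in> V"
    using assms subtwins_subset by blast
qed

lemma subtwins_of_degree_3:
  assumes "nbs v = {a, b, c}" "a \<noteq> b" "a \<noteq> c" "b \<noteq> c"
  obtains x y where "x \<in> subtwins v" "y \<in> subtwins v" "x \<noteq> y"
proof -
  have "v \<in> V"
    using assms(1) nbs_nonempty_in by blast
  moreover have "card (nbs v) = 3"
    unfolding assms(1) using assms(2-4) by simp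
  ultimately have "2 \<le> card (subtwins v)"
    using tight[of v] by linarith
  then show ?thesis
    using that by (rule two_distinct_elements)
qed

lemma subtwins_of_degree_2:
  assumes "nbs v = {a, b}" "a \<noteq> b"
  obtains x where "x \<in> subtwins v"
proof -
  have "v \<in> V"
    using assms(1) nbs_nonempty_in by blast
  moreover have "card (nbs v) = 2"
    unfolding assms(1) using assms(2) by simp
  ultimately have "subtwins v \<noteq> {}"
    using tight[of v] by force
  then show ?thesis
    using that by blast
qed



text \<open>Closes the cases with an explicit vertex list: once the vertices found so far have all
  their neighbours among themselves, connectedness leaves no others. Non-empty neighbourhoods ensure
  membership in \<open>V\<close>.\<close>

lemma V_eqI:
  assumes "A \<noteq> {}" "\<And>x. x \<in> A \<Longrightarrow> nbs x \<noteq> {} \<and> nbs x \<subseteq> A"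
  shows "A = V"
  using assms nbs_nonempty_in by (intro conn) blast+

lemma no_leaf_cases:
  assumes no_leaf: "\<And>v u. nbs v \<noteq> {u}"
  shows "copy_of G\<^sub>1 V E \<or> copy_of G\<^sub>2 V E"
proof (cases "\<exists>v a b. nbs v = {a, b}")
  case True
  then obtain v a b where v: "nbs v = {a, b}"
    by auto
  have "a \<noteq> b"
    using v no_leaf[of v a] by auto
  obtain w where w: "w \<in> subtwins v"
    using subtwins_of_degree_2[OF v \<open>a \<noteq> b\<close>] .
  have nw: "nbs w = {a, b}" and "w \<noteq> v"
    using subtwinsD[OF w] no_leaf[of w] unfolding v by blast+
  have vw: "nbs c = {v, w}" if "c \<in> {a, b}" for c
  proof -
    have "v \<in> nbs c" "w \<in> nbs c"
      using that v nw in_nbs_sym by blast+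
    then show ?thesis
    proof (rule nbs_cases)
      show "v \<noteq> w"
        using \<open>w \<noteq> v\<close> by simp
      fix d assume d: "nbs c = {v, w, d}" "d \<noteq> v" "d \<noteq> w"
      obtain x y where xy: "x \<in> subtwins c" "y \<in> subtwins c" "x \<noteq> y"
        using subtwins_of_degree_3[OF d(1)] d \<open>w \<noteq> v\<close> by metis
      \<comment> \<open>Not being a leaf at \<open>d\<close>, a subtwin of \<open>c\<close> is
        adjacent to \<open>v\<close> or \<open>w\<close>. Only one of \<open>a\<close> and
        \<open>b\<close> differs from \<open>c\<close>, whereas degree 3 demands two
        subtwins.\<close>
      have "z \<in> {a, b}" if "z \<in> subtwins c" for z
      proof -
        have "v \<in> nbs z \<or> w \<in> nbs z"
          using subtwinsD[OF that] no_leaf[of z d] unfolding d by blast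
        then show ?thesis
          using in_nbs_sym v nw by blast
      qed
      then show ?thesis
        using xy subtwinsD(1) that by blast
    qed
  qed
  have "v \<noteq> a" "v \<noteq> b" "w \<noteq> a" "w \<noteq> b"
    using v nw nbs_neq by blast+
  have "{a, b, v, w} = V"
    by (rule V_eqI) (use vw v nw in auto)
  moreover have nab: "nbs a = {v, w}" "nbs b = {v, w}"
    using vw by auto
  moreover have "distinct [a, b, v, w]"
    using \<open>a \<noteq> b\<close> \<open>w \<noteq> v\<close> \<open>v \<noteq> a\<close> \<open>v \<noteq> b\<close> \<open>w \<noteq> a\<close> \<open>w \<noteq> b\<close> by auto
  moreover have "\<forall>i \<in> {..<4}. \<forall>j \<in> {..<4}.
        E ([a, b, v, w] ! i) ([a, b, v, w] ! j) \<longleftrightarrow> (i, j) \<in> parcs G\<^sub>1"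
    using \<open>distinct [a, b, v, w]\<close> unfolding lessThan_4_6 G1_simps
      by (auto simp: E_iff v nw nab)
  ultimately have "copy_of G\<^sub>1 V E"
    by (intro copy_of_listI[of "[a, b, v, w]"]) (simp_all add: G1_simps)
  then show ?thesis ..
next
  case False
  obtain v where "v \<in> V"
    using V_nonempty by auto
  have deg3: "card (nbs x) = 3" if "x \<in> V" for x
  proof -
    have "card (nbs x) \<noteq> 0" "card (nbs x) \<noteq> 1" "card (nbs x) \<noteq> 2"
      using nbs_nonempty[OF that] no_leaf False by (auto simp: card_1_singleton_iff card_2_iff)
    then show ?thesis
      using card_nbs_le[of x] by linarith
  qed
  obtain a b c where v: "nbs v = {a, b, c}" "a \<noteq> b" "a \<noteq> c" "b \<noteq> c"
    using deg3[OF \<open>v \<in> V\<close>] by (auto simp: card_3_iff)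
  obtain x y where xy: "x \<in> subtwins v" "y \<in> subtwins v" "x \<noteq> y"
    using subtwins_of_degree_3[OF v] .
  have twin: "nbs z = {a, b, c}" if "z \<in> subtwins v" for z
    using subtwinsD[OF that] deg3[of z] deg3[OF \<open>v \<in> V\<close>] v(1)
    by (metis card_seteq finite_nbs order_refl)
  have nxy: "nbs x = {a, b, c}" "nbs y = {a, b, c}" "x \<noteq> v" "y \<noteq> v"
    using twin xy subtwinsD(1) by auto
  have nabc: "nbs d = {v, x, y}" if "d \<in> {a, b, c}" for d
    using that v nxy xy(3) in_nbs_sym by (intro nbs_eq3) blast+
  have ne: "d \<noteq> v \<and> d \<noteq> x \<and> d \<noteq> y" if "d \<in> {a, b, c}" for d
  proof -
    have "d \<in> nbs v" "d \<in> nbs x" "d \<in> nbs y"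
      using that v(1) nxy(1,2) by simp_all
    then show ?thesis
      by auto
  qed
  have "{v, x, y, a, b, c} = V"
    by (rule V_eqI) (use v nxy nabc in auto)
  moreover have nabc': "nbs a = {v, x, y}" "nbs b = {v, x, y}" "nbs c = {v, x, y}"
    using nabc by auto
  moreover have "distinct [v, x, y, a, b, c]"
    using v(2-4) nxy(3,4) xy(3) ne[of a] ne[of b] ne[of c] by auto
  moreover have "\<forall>i \<in> {..<6}. \<forall>j \<in> {..<6}.
        E ([v, x, y, a, b, c] ! i) ([v, x, y, a, b, c] ! j) \<longleftrightarrow> (i, j) \<in> parcs G\<^sub>2"
    using \<open>distinct [v, x, y, a, b, c]\<close> unfolding lessThan_4_6 G2_simps
      by (auto simp: E_iff v(1) nxy(1,2) nabc')
  ultimately have "copy_of G\<^sub>2 V E"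
    by (intro copy_of_listI[of "[v, x, y, a, b, c]"]) (simp_all add: G2_simps)
  then show ?thesis ..
qed

text \<open>A subtwin of \<open>u\<close> sees neither of the leaves \<open>v\<close> and
  \<open>w\<close>. So \<open>u\<close> has a third neighbour \<open>x\<close>, the two subtwins
  that it must then have are leaves at \<open>x\<close>, and \<open>x\<close> has no further
  neighbours.\<close>

lemma two_leaves_case:
  assumes v: "nbs v = {u}" and w: "nbs w = {u}" and "v \<noteq> w"
  shows "copy_of G\<^sub>4 V E"
proof -
  have vw: "v \<in> nbs u" "w \<in> nbs u"
    using v w in_nbs_sym by blast+
  have nz: "nbs z \<subseteq> nbs u - {v, w}" "nbs z \<noteq> {}" if "z \<in> subtwins u" for z
    using subtwinsD[OF that] v w in_nbs_sym by blast+
  show ?thesis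
  proof (rule nbs_cases[OF vw \<open>v \<noteq> w\<close>])
    assume "nbs u = {v, w}"
    then show ?thesis
      using subtwins_of_degree_2[OF _ \<open>v \<noteq> w\<close>] nz by (metis Diff_cancel subset_empty)
  next
    fix x assume x: "nbs u = {v, w, x}" "x \<noteq> v" "x \<noteq> w"
    obtain y z where yz: "y \<in> subtwins u" "z \<in> subtwins u" "y \<noteq> z"
      using subtwins_of_degree_3[OF x(1)] x(2,3) \<open>v \<noteq> w\<close> by metis
    have ny: "nbs y = {x}" and nz: "nbs z = {x}"
      using nz yz x by blast+
    have "y \<noteq> u" "z \<noteq> u"
      using yz subtwinsD(1) by auto
    have nx: "nbs x = {u, y, z}"
      using x(1) ny nz yz(3) \<open>y \<noteq> u\<close> \<open>z \<noteq> u\<close> in_nbs_sym by (intro nbs_eq3) blast+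
    have ne: "u \<noteq> v" "u \<noteq> w" "u \<noteq> x" "x \<noteq> y" "x \<noteq> z"
      using x(1) nx nbs_neq by blast+
    then have "y \<noteq> v" "y \<noteq> w" "z \<noteq> v" "z \<noteq> w"
      using v w ny nz by auto
    then have "distinct [u, x, v, w, y, z]"
      using ne x(2,3) yz(3) \<open>v \<noteq> w\<close> \<open>y \<noteq> u\<close> \<open>z \<noteq> u\<close> by auto
    moreover have "{u, x, v, w, y, z} = V"
      by (rule V_eqI) (use v w x(1) nx ny nz in auto)
    moreover have "\<forall>i \<in> {..<6}. \<forall>j \<in> {..<6}.
        E ([u, x, v, w, y, z] ! i) ([u, x, v, w, y, z] ! j) \<longleftrightarrow> (i, j) \<in> parcs G\<^sub>4"
      using \<open>distinct [u, x, v, w, y, z]\<close> unfolding lessThan_4_6 G4_simps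
      by (auto simp: E_iff v w x(1) nx ny nz)
    ultimately show ?thesis
      by (intro copy_of_listI[of "[u, x, v, w, y, z]"]) (simp_all add: G4_simps)
  qed
qed

text \<open>The two leaves form a whole component, and a single edge is the corona of the one-vertex
  path.\<close>

lemma adjacent_leaves_case:
  assumes v: "nbs v = {u}" and u: "nbs u = {v}"
  shows "copy_of (cor (path_graph 1)) V E"
proof -
  have "u \<noteq> v"
    using u not_in_nbs_self[of u] by auto
  have V: "{u, v} = V"
    by (rule V_eqI) (use v u in auto)
  let ?h = "case_sum (\<lambda>_. u) (\<lambda>_. v) :: nat + nat \<Rightarrow> 'a"
  have verts: "pverts (cor (path_graph 1)) = {Inl 0, Inr 0}"
    by (auto simp: pverts_cor)
  have "bij_betw ?h {Inl 0, Inr 0} V"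
    unfolding bij_betw_def V[symmetric] using \<open>u \<noteq> v\<close> by simp
  moreover have "\<forall>i \<in> {Inl 0, Inr 0}. \<forall>j \<in> {Inl 0, Inr 0}.
      E (?h i) (?h j) \<longleftrightarrow> (i, j) \<in> parcs (cor (path_graph 1))"
    using u v \<open>u \<noteq> v\<close> by (simp add: E_iff parcs_path_graph_iff)
  ultimately show ?thesis
    unfolding copy_of_def verts by blast
qed

definition supports :: "'a set" where
  "supports = {u. \<exists>l. nbs l = {u}}"

text \<open>The vertices split into support vertices and leaves, with exactly one leaf at each
  support vertex. That leaf takes one of at most three places, so the support vertices induce a
  connected graph of maximum degree at most 2, and \<open>G\<close> is its corona.\<close>

lemma corona_case:
  assumes unique_leaf: "\<And>v w u. nbs v = {u} \<Longrightarrow> nbs w = {u} \<Longrightarrow> v = w"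
    and leaf_not_support: "\<And>v u w. nbs v = {u} \<Longrightarrow> nbs u \<noteq> {w}"
    and all: "\<And>x. x \<in> V \<Longrightarrow> x \<notin> supports \<Longrightarrow> \<exists>u. nbs x = {u}"
  shows "(\<exists>k \<ge> 1. copy_of (cor (path_graph k)) V E) \<or> (\<exists>k \<ge> 3. copy_of (cor (cycle_graph k)) V E)"
proof -
  \<comment> \<open>The leaf at \<open>u\<close>, meaningful for \<open>u\<close> in
    \<open>supports\<close>, where \<open>unique_leaf\<close> makes the description proper.\<close>
  define lf where "lf u = (THE l. nbs l = {u})" for u
  have lf: "nbs (lf u) = {u}" if u: "u \<in> supports" for u
  proof -
    obtain l where l: "nbs l = {u}"
      using u unfolding supports_def by blast
    then have "lf u = l"
      unfolding lf_def using unique_leaf by (intro the_equality)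
    then show ?thesis
      using l by simp
  qed
  have lf_eq: "l = lf u" if "nbs l = {u}" for l u
  proof -
    have "u \<in> supports"
      using that by (auto simp: supports_def)
    then show ?thesis
      using unique_leaf[OF that lf] by simp
  qed
  have lf_notin: "lf u \<notin> supports" if "u \<in> supports" for u
    using lf[OF that] leaf_not_support unfolding supports_def by blast
  have lf_in: "lf u \<in> nbs u" if "u \<in> supports" for u
    using lf[OF that] in_nbs_sym by blast
  have lf_only: "y = lf u" if y: "y \<in> nbs u" "y \<notin> supports" for u y
  proof -
    obtain w where w: "nbs y = {w}"
      using all[OF nbs_in_V(2)[OF y(1)] y(2)] by blast
    then have "w = u"
      using in_nbs_sym[OF y(1)] by simp
    then show ?thesis
      using w lf_eq by blast
  qed
  have sub: "supports \<subseteq> V"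
    using nbs_in_V unfolding supports_def by blast
  have V_eq: "V = supports \<union> lf ` supports"
  proof
    show "supports \<union> lf ` supports \<subseteq> V"
      using sub lf_in nbs_in_V by blast
    show "V \<subseteq> supports \<union> lf ` supports"
    proof
      fix x assume "x \<in> V"
      show "x \<in> supports \<union> lf ` supports"
      proof (cases "x \<in> supports")
        case False
        then obtain u where "nbs x = {u}"
          using all \<open>x \<in> V\<close> by blast
        then show ?thesis
          using lf_eq unfolding supports_def by blast
      qed simp
    qed
  qed
  define F where "F u v \<longleftrightarrow> E u v \<and> u \<in> supports \<and> v \<in> supports" for u v
  \<comment> \<open>The copy on the support vertices is extended by sending \<open>Inr i\<close> to
    the leaf at \<open>g i\<close>.\<close>
  have cor: "copy_of (cor H) V E" if copy: "copy_of H supports F" for H :: "nat pair_pre_digraph"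
  proof -
    obtain g where g: "bij_betw g (pverts H) supports"
      and gE: "\<And>i j. i \<in> pverts H \<Longrightarrow> j \<in> pverts H \<Longrightarrow> F (g i) (g j) \<longleftrightarrow> (i, j) \<in> parcs H"
      using copy unfolding copy_of_def by blast
    have g_in: "g i \<in> supports" if "i \<in> pverts H" for i
      using g that by (auto simp: bij_betw_def)
    have g_inj: "g i = g j \<longleftrightarrow> i = j" if "i \<in> pverts H" "j \<in> pverts H" for i j
      using g that by (auto simp: bij_betw_def inj_on_def)
    let ?h = "case_sum g (\<lambda>i. lf (g i))"
    have lf_inj: "lf u = lf v \<longleftrightarrow> u = v" if "u \<in> supports" "v \<in> supports" for u v
      using lf[OF that(1)] lf[OF that(2)] singleton_inject by metis
    have ne: "g i \<noteq> lf (g j)" "lf (g j) \<noteq> g i" if "i \<in> pverts H" "j \<in> pverts H" for i j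
      using lf_notin g_in that by metis+
    have "bij_betw ?h (pverts (cor H)) V"
      unfolding bij_betw_def
    proof
      show "inj_on ?h (pverts (cor H))"
        by (rule inj_onI) (auto simp: pverts_cor g_inj lf_inj g_in ne)
      have "?h ` pverts (cor H) = g ` pverts H \<union> lf ` g ` pverts H"
        by (simp add: pverts_cor Plus_def image_Un image_image)
      then show "?h ` pverts (cor H) = V"
        using g V_eq by (simp add: bij_betw_def)
    qed
    moreover have "E (?h i) (?h j) \<longleftrightarrow> (i, j) \<in> parcs (cor H)"
      if ij: "i \<in> pverts (cor H)" "j \<in> pverts (cor H)" for i j
    proof -
      have ll: "E (g a) (g b) \<longleftrightarrow> (a, b) \<in> parcs H" if "a \<in> pverts H" "b \<in> pverts H" for a b
        using gE[OF that] g_in that by (simp add: F_def)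
      have rl: "E (lf (g a)) y \<longleftrightarrow> y = g a" if "a \<in> pverts H" for a y
        using lf[OF g_in[OF that]] by (simp add: E_iff)
      have lr: "E y (lf (g a)) \<longleftrightarrow> y = g a" if "a \<in> pverts H" for a y
        using rl[OF that, of y] E_sym by blast
      show ?thesis
        using ij by (auto simp: pverts_cor ll rl lr g_inj ne)
    qed
    ultimately show ?thesis
      unfolding copy_of_def by blast
  qed
  have "(\<exists>k \<ge> 1. copy_of (path_graph k) supports F) \<or> (\<exists>k \<ge> 3. copy_of (cycle_graph k) supports F)"
  proof (rule connected_max_degree_2_path_or_cycle)
    show "finite supports"
      using sub finite_V by (rule finite_subset)
    show "supports \<noteq> {}"
      using V_eq V_nonempty by auto
    show "card {w. F v w} \<le> 2" for v
    proof (cases "v \<in> supports")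
      case True
      have "{w. F v w} \<subseteq> nbs v - {lf v}"
        using lf_notin True by (auto simp: F_def E_iff)
      then have "card {w. F v w} \<le> card (nbs v - {lf v})"
        by (intro card_mono) auto
      also have "\<dots> \<le> 2"
        using lf_in[OF True] card_nbs_le[of v] by simp
      finally show ?thesis .
    qed (simp add: F_def)
    fix A assume A: "A \<subseteq> supports" "A \<noteq> {}" and closed: "\<And>x y. x \<in> A \<Longrightarrow> F x y \<Longrightarrow> y \<in> A"
    \<comment> \<open>A closed set of support vertices becomes closed in the whole graph when its
      leaves are added, since any other neighbour is again a support vertex.\<close>
    have "A \<union> lf ` A = V"
    proof (rule conn)
      show "A \<union> lf ` A \<subseteq> V"
        using A V_eq by blast
      show "A \<union> lf ` A \<noteq> {}"
        using A by blast
      fix x assume "x \<in> A \<union> lf ` A"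
      then consider "x \<in> A" | u where "u \<in> A" "x = lf u"
        by blast
      then show "nbs x \<subseteq> A \<union> lf ` A"
      proof cases
        case 1
        show ?thesis
        proof
          fix y assume y: "y \<in> nbs x"
          show "y \<in> A \<union> lf ` A"
          proof (cases "y \<in> supports")
            case True
            then show ?thesis
              using closed[OF 1, of y] y A 1 by (auto simp: F_def E_iff)
          next
            case False
            then show ?thesis
              using lf_only[of y x] y A 1 by blast
          qed
        qed
      next
        case 2
        then show ?thesis
          using lf[of u] A by auto
      qed
    qed
    then show "A = supports"
      using A sub lf_notin by blast
  qed (auto simp: F_def E_sym E_irrefl)
  then show ?thesis
    using cor by blast
qed

text \<open>No subtwin of \<open>u\<close> is adjacent to the leaf \<open>l\<close>, nor is any a
  leaf at \<open>x\<close>. This forces a third neighbour \<open>y\<close> of \<open>u\<close> and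
  two subtwins \<open>p\<close> and \<open>q\<close>, where \<open>p\<close> has neighbourhood {x,
  y} and \<open>q\<close> has {x, y} or {y}. The first option for \<open>q\<close> gives
  \<open>G\<^sub>3\<close>; the second gives \<open>G\<^sub>5\<close> once a third neighbour
  \<open>t\<close> of \<open>x\<close> is excluded.\<close>

lemma inner_vertex_case:
  assumes unique_leaf: "\<And>v w u. nbs v = {u} \<Longrightarrow> nbs w = {u} \<Longrightarrow> v = w"
    and l: "nbs l = {u}" and xu: "x \<in> nbs u"
    and x_not_leaf: "\<And>w. nbs x \<noteq> {w}" and x_not_support: "\<And>w. nbs w \<noteq> {x}"
  shows "copy_of G\<^sub>3 V E \<or> copy_of G\<^sub>5 V E"
proof -
  have lu: "l \<in> nbs u"
    using l in_nbs_sym by blast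
  have "l \<noteq> x"
    using l x_not_leaf by blast
  have l_notin: "l \<notin> nbs z" if "z \<noteq> u" for z
    using l in_nbs_sym[of l z] that by blast
  have "nbs u \<noteq> {l, x}"
  proof
    assume u: "nbs u = {l, x}"
    obtain z where "z \<in> subtwins u"
      using subtwins_of_degree_2[OF u \<open>l \<noteq> x\<close>] .
    then show False
      using subtwinsD[of z u] l_notin[of z] x_not_support[of z] unfolding u by blast
  qed
  then obtain y where u: "nbs u = {l, x, y}" "y \<noteq> l" "y \<noteq> x"
    using nbs_cases[OF lu xu \<open>l \<noteq> x\<close>] by metis
  have nz: "nbs z = {x, y} \<or> nbs z = {y}" if "z \<in> subtwins u" for z
    using subtwinsD[OF that] l_notin[of z] x_not_support[of z] unfolding u by blast
  obtain z1 z2 where z: "z1 \<in> subtwins u" "z2 \<in> subtwins u" "z1 \<noteq> z2"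
    using subtwins_of_degree_3[OF u(1)] u(2,3) \<open>l \<noteq> x\<close> by metis
  \<comment> \<open>Both subtwins cannot be leaves at \<open>y\<close>, so at least one has the
    neighbourhood {x, y}.\<close>
  have "\<not> (nbs z1 = {y} \<and> nbs z2 = {y})"
    using unique_leaf z(3) by blast
  then obtain p q where p: "p \<in> subtwins u" "nbs p = {x, y}" and q: "q \<in> subtwins u" "p \<noteq> q"
    using nz[OF z(1)] nz[OF z(2)] z by metis
  have pq_notin: "p \<noteq> u" "q \<noteq> u" "p \<notin> nbs u" "q \<notin> nbs u"
    using p q subtwinsD by blast+
  then have ne: "p \<noteq> l" "p \<noteq> x" "p \<noteq> y" "q \<noteq> l" "q \<noteq> x" "q \<noteq> y"
    unfolding u by blast+
  have ne': "u \<noteq> l" "u \<noteq> x" "u \<noteq> y"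
    using u nbs_neq by blast+
  have ux: "u \<in> nbs x" "p \<in> nbs x" and uy: "u \<in> nbs y" "p \<in> nbs y"
    using u p(2) in_nbs_sym by blast+
  show ?thesis
  proof (cases "nbs q = {x, y}")
    case True
    have nxy: "nbs c = {u, p, q}" if "c \<in> {x, y}" for c
      using that True ux uy pq_notin q(2) in_nbs_sym by (intro nbs_eq3) blast+
    then have nx: "nbs x = {u, p, q}" and ny: "nbs y = {u, p, q}"
      by auto
    have "distinct [x, y, u, p, q, l]"
      using ne ne' pq_notin(1,2) q(2) u(2,3) \<open>l \<noteq> x\<close> by auto
    moreover have "{x, y, u, p, q, l} = V"
      by (rule V_eqI) (use u(1) l p(2) True nx ny in auto)
    moreover have "\<forall>i \<in> {..<6}. \<forall>j \<in> {..<6}.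
        E ([x, y, u, p, q, l] ! i) ([x, y, u, p, q, l] ! j) \<longleftrightarrow> (i, j) \<in> parcs G\<^sub>3"
      using \<open>distinct [x, y, u, p, q, l]\<close> unfolding lessThan_4_6 G3_simps
      by (auto simp: E_iff u(1) l p(2) True nx ny)
    ultimately have "copy_of G\<^sub>3 V E"
      by (intro copy_of_listI[of "[x, y, u, p, q, l]"]) (simp_all add: G3_simps)
    then show ?thesis ..
  next
    case False
    then have nq: "nbs q = {y}"
      using nz[OF q(1)] by blast
    have ny: "nbs y = {u, p, q}"
      using nq uy pq_notin q(2) in_nbs_sym by (intro nbs_eq3) blast+
    show ?thesis
    proof (rule nbs_cases[OF ux pq_notin(1)[symmetric]])
      assume nx: "nbs x = {u, p}"
      have "distinct [l, u, x, p, y, q]"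
        using ne ne' pq_notin(1,2) q(2) u(2,3) \<open>l \<noteq> x\<close> by auto
      moreover have "{l, u, x, p, y, q} = V"
        by (rule V_eqI) (use u(1) l p(2) nq nx ny in auto)
      moreover have "\<forall>i \<in> {..<6}. \<forall>j \<in> {..<6}.
        E ([l, u, x, p, y, q] ! i) ([l, u, x, p, y, q] ! j) \<longleftrightarrow> (i, j) \<in> parcs G\<^sub>5"
        using \<open>distinct [l, u, x, p, y, q]\<close> unfolding lessThan_4_6 G5_simps
      by (auto simp: E_iff u(1) l p(2) nq nx ny)
      ultimately have "copy_of G\<^sub>5 V E"
        by (intro copy_of_listI[of "[l, u, x, p, y, q]"]) (simp_all add: G5_simps)
      then show ?thesis ..
    next
      fix t assume nx: "nbs x = {u, p, t}" and t: "t \<noteq> u" "t \<noteq> p"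
      have xt: "x \<in> nbs t"
        using nx in_nbs_sym by blast
      have "t \<noteq> q"
        using xt nq u(3) by auto
      \<comment> \<open>A subtwin of \<open>x\<close> adjacent to \<open>u\<close> or
        \<open>p\<close> lies in {l, x, y}; here \<open>x\<close> is excluded as the vertex itself
        and \<open>y\<close> because it is adjacent to \<open>q\<close>.\<close>
      have tx: "z = l \<or> nbs z = {t}" if "z \<in> subtwins x" for z
      proof -
        have "z \<noteq> x" "nbs z \<noteq> {}" "nbs z \<subseteq> {u, p, t}"
          using subtwinsD[OF that] unfolding nx by auto
        moreover have "z \<noteq> y"
          using \<open>nbs z \<subseteq> {u, p, t}\<close> ny pq_notin(2) q(2) \<open>t \<noteq> q\<close> by auto
        moreover have "z \<in> {x, y}" if "p \<in> nbs z"
          using that in_nbs_sym p(2) by blast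
        moreover have "z \<in> {l, x, y}" if "u \<in> nbs z"
          using that in_nbs_sym u(1) by blast
        ultimately show ?thesis
          by blast
      qed
      obtain z1 z2 where "z1 \<in> subtwins x" "z2 \<in> subtwins x" "z1 \<noteq> z2"
        using subtwins_of_degree_3[OF nx] t pq_notin(1) by metis
      \<comment> \<open>At most one of the two subtwins is \<open>l\<close>; the other is a leaf at
        \<open>t\<close>.\<close>
      then obtain r where r: "nbs r = {t}"
        using tx by metis
      have "r \<noteq> x"
        using r x_not_leaf by blast
      have rt: "r \<in> nbs t"
        using r in_nbs_sym by blast
      \<comment> \<open>The neighbours of \<open>x\<close> other than \<open>t\<close> are
        \<open>u\<close> and \<open>p\<close>. They are not subtwins of \<open>t\<close>, as
        \<open>l\<close> and \<open>y\<close> are not adjacent to \<open>t\<close>; and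
        \<open>r\<close> is adjacent to \<open>t\<close> alone.\<close>
      have zt: "x \<notin> nbs z \<and> r \<notin> nbs z" if "z \<in> subtwins t" for z
      proof -
        have z: "z \<noteq> t" "nbs z \<subseteq> nbs t"
          using subtwinsD[OF that] by auto
        have "z \<noteq> u"
          using z(2) lu l t(1) in_nbs_sym[of l t] by auto
        moreover have "z \<noteq> p"
          using z(2) p(2) ny t \<open>t \<noteq> q\<close> in_nbs_sym[of y t] by auto
        ultimately show ?thesis
          using z(1) in_nbs_sym[of x z] in_nbs_sym[of r z] nx r by blast
      qed
      show ?thesis
      proof (rule nbs_cases[OF xt rt \<open>r \<noteq> x\<close>[symmetric]])
        assume nt: "nbs t = {x, r}"
        obtain z where "z \<in> subtwins t"
          using subtwins_of_degree_2[OF nt \<open>r \<noteq> x\<close>[symmetric]] .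
        then show ?thesis
          using zt[of z] subtwinsD[of z t] unfolding nt by blast
      next
        fix s assume nt: "nbs t = {x, r, s}" and s: "s \<noteq> x" "s \<noteq> r"
        obtain z1 z2 where z: "z1 \<in> subtwins t" "z2 \<in> subtwins t" "z1 \<noteq> z2"
          using subtwins_of_degree_3[OF nt] s \<open>r \<noteq> x\<close> by metis
        \<comment> \<open>Two distinct leaves would hang at \<open>s\<close>, against
          \<open>unique_leaf\<close>.\<close>
        have "nbs z = {s}" if "z \<in> subtwins t" for z
          using zt[OF that] subtwinsD(2,3)[OF that] unfolding nt by blast
        then show ?thesis
          using unique_leaf z by blast
      qed
    qed
  qed
qed

text \<open>Splits by the position of the leaves. In the last case no leaf is a support vertex and
  no two share one; then either all vertices are leaves or support vertices, or connectedness
  supplies an edge to a vertex that is neither.\<close>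

lemma tight_graph_classification:
  "(\<exists>H \<in> {G\<^sub>1, G\<^sub>2, G\<^sub>3, G\<^sub>4, G\<^sub>5}. copy_of H V E) \<or>
    (\<exists>k \<ge> 1. copy_of (cor (path_graph k)) V E) \<or> (\<exists>k \<ge> 3. copy_of (cor (cycle_graph k)) V E)"
proof -
  consider (no_leaf) "\<And>v u. nbs v \<noteq> {u}"
    | (two_leaves) v w u where "nbs v = {u}" "nbs w = {u}" "v \<noteq> w"
    | (adjacent_leaves) v u where "nbs v = {u}" "nbs u = {v}"
    | (pendant) l\<^sub>0 u\<^sub>0 where "nbs l\<^sub>0 = {u\<^sub>0}"
        "\<And>v w u. nbs v = {u} \<Longrightarrow> nbs w = {u} \<Longrightarrow> v = w"
        "\<And>v u w. nbs v = {u} \<Longrightarrow> nbs u \<noteq> {w}"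
    using in_nbs_sym by (metis singletonD singletonI)
  then show ?thesis
  proof cases
    case no_leaf
    then show ?thesis
      using no_leaf_cases by blast
  next
    case two_leaves
    then show ?thesis
      using two_leaves_case by blast
  next
    case adjacent_leaves
    then have "copy_of (cor (path_graph 1)) V E"
      by (rule adjacent_leaves_case)
    then show ?thesis
      by blast
  next
    case pendant
    define A where "A = {x \<in> V. x \<in> supports \<or> (\<exists>u. nbs x = {u})}"
    show ?thesis
    proof (cases "A = V")
      case True
      then have all: "\<exists>u. nbs x = {u}" if "x \<in> V" "x \<notin> supports" for x
        using that unfolding A_def by blast
      have "(\<exists>k \<ge> 1. copy_of (cor (path_graph k)) V E) \<or> (\<exists>k \<ge> 3. copy_of (cor (cycle_graph k)) V E)"
        by (rule corona_case) (fact pendant(2) pendant(3) all)+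
      then show ?thesis
        by blast
    next
      case False
      have "l\<^sub>0 \<in> A"
        using pendant(1) nbs_in_V unfolding A_def by blast
      then obtain u x where u: "u \<in> A" "x \<in> nbs u" "x \<notin> A"
        using False conn[of A] unfolding A_def by blast
      have x: "x \<notin> supports" "\<And>w. nbs x \<noteq> {w}"
        using u nbs_in_V unfolding A_def by blast+
      \<comment> \<open>If \<open>u\<close> were a leaf, its only neighbour would be
        \<open>x\<close>, which would then be a support vertex.\<close>
      have "u \<in> supports"
      proof (rule ccontr)
        assume "u \<notin> supports"
        then obtain w where "nbs u = {w}"
          using u(1) unfolding A_def by blast
        then have "nbs u = {x}"
          using u(2) by simp
        then show False
          using x(1) unfolding supports_def by blast
      qed
      then obtain l where "nbs l = {u}"
        unfolding supports_def by blast
      have x': "nbs w \<noteq> {x}" for w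
        using x(1) unfolding supports_def by blast
      have "copy_of G\<^sub>3 V E \<or> copy_of G\<^sub>5 V E"
        by (rule inner_vertex_case) (fact pendant(2) \<open>nbs l = {u}\<close> u(2) x(2) x')+
      then show ?thesis
        by blast
    qed
  qed
qed

end

section \<open>Isomorphisms and the converse\<close>

lemma copy_of_card: "copy_of H V E \<Longrightarrow> card V = card (pverts H)"
  unfolding copy_of_def using bij_betw_same_card by metis

text \<open>Without multiple arcs an arc is determined by its ends, so a bijection of the vertices
  that respects adjacency in both directions induces one of the arcs.\<close>

lemma (in graph) digraph_iso_iff_copy_of:
  assumes "pair_graph H"
  shows "digraph_iso G (with_proj H) \<longleftrightarrow> copy_of H (verts G) (\<lambda>u v. u \<rightarrow>\<^bsub>G\<^esub> v)"
proof
  assume "digraph_iso G (with_proj H)"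
  then obtain f where f: "digraph_isomorphism f" and H: "with_proj H = app_iso f G"
    unfolding digraph_iso_def by blast
  let ?f = "iso_verts f"
  have inj: "inj_on ?f (verts G)"
    using f by (rule digraph_isomorphism_inj_on_verts)
  have verts: "pverts H = ?f ` verts G"
    using arg_cong[OF H, of verts] by simp
  have arcs: "parcs H = (\<lambda>(u, v). (?f u, ?f v)) ` arcs_ends G"
    using arg_cong[OF H, of arcs_ends] arcs_ends_app_iso_eq[OF f] by simp
  let ?g = "the_inv_into (verts G) ?f"
  have "bij_betw ?g (pverts H) (verts G)"
    using inj verts by (intro bij_betw_the_inv_into) (simp add: bij_betw_def)
  moreover have "?g i \<rightarrow>\<^bsub>G\<^esub> ?g j \<longleftrightarrow> (i, j) \<in> parcs H" if "i \<in> pverts H" "j \<in> pverts H" for i j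
  proof -
    from that obtain u v where uv: "i = ?f u" "j = ?f v" "u \<in> verts G" "v \<in> verts G"
      using verts by blast
    have "(?f u, ?f v) \<in> parcs H \<longleftrightarrow> u \<rightarrow>\<^bsub>G\<^esub> v"
    proof
      assume "(?f u, ?f v) \<in> parcs H"
      then obtain u' v' where "u' \<rightarrow>\<^bsub>G\<^esub> v'" "?f u = ?f u'" "?f v = ?f v'"
        unfolding arcs by auto
      then show "u \<rightarrow>\<^bsub>G\<^esub> v"
        using uv inj adj_in_verts by (metis inj_onD)
    qed (auto simp: arcs intro: rev_image_eqI)
    then show ?thesis
      using uv by (simp add: the_inv_into_f_f[OF inj])
  qed
  ultimately show "copy_of H (verts G) (\<lambda>u v. u \<rightarrow>\<^bsub>G\<^esub> v)"
    unfolding copy_of_def by blast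
next
  assume "copy_of H (verts G) (\<lambda>u v. u \<rightarrow>\<^bsub>G\<^esub> v)"
  then obtain g where g: "bij_betw g (pverts H) (verts G)"
    and gE: "\<And>i j. i \<in> pverts H \<Longrightarrow> j \<in> pverts H \<Longrightarrow> g i \<rightarrow>\<^bsub>G\<^esub> g j \<longleftrightarrow> (i, j) \<in> parcs H"
    unfolding copy_of_def by blast
  interpret H: pair_graph H by fact
  let ?f = "the_inv_into (pverts H) g"
  have inj: "inj_on g (pverts H)" and im: "g ` pverts H = verts G"
    using g by (auto simp: bij_betw_def)
  have f: "bij_betw ?f (verts G) (pverts H)"
    using g by (rule bij_betw_the_inv_into)
  have gf: "g (?f v) = v" if "v \<in> verts G" for v
    using that im inj by (simp add: f_the_inv_into_f)
  have f_in: "?f v \<in> pverts H" if "v \<in> verts G" for v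
    using that f by (auto simp: bij_betw_def)
  \<comment> \<open>The arcs of \<open>with_proj H\<close> are pairs of vertices, so each arc has to
    go to the pair of images of its ends.\<close>
  define hom where "hom = \<lparr>iso_verts = ?f, iso_arcs = (\<lambda>a. (?f (tail G a), ?f (head G a))),
    iso_head = snd, iso_tail = fst\<rparr>"
  have "digraph_isomorphism hom"
    unfolding digraph_isomorphism_def
  proof (intro conjI)
    show "inj_on (iso_arcs hom) (arcs G)"
    proof (rule inj_onI)
      fix a b assume ab: "a \<in> arcs G" "b \<in> arcs G" "iso_arcs hom a = iso_arcs hom b"
      then have "tail G a = tail G b" "head G a = head G b"
        using f by (auto simp: hom_def bij_betw_def inj_on_eq_iff)
      then show "a = b"
        using ab no_multi_arcs by (simp add: arc_to_ends_def)
    qed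
  qed (use f wf_digraph in \<open>auto simp: hom_def bij_betw_def\<close>)
  moreover have "with_proj H = app_iso hom G"
  proof -
    have "(\<lambda>a. (?f (tail G a), ?f (head G a))) ` arcs G = parcs H"
    proof (intro equalityI subsetI)
      fix e assume "e \<in> (\<lambda>a. (?f (tail G a), ?f (head G a))) ` arcs G"
      then obtain a where a: "a \<in> arcs G" "e = (?f (tail G a), ?f (head G a))"
        by blast
      then have "tail G a \<rightarrow>\<^bsub>G\<^esub> head G a"
        by (auto simp: arcs_ends_conv)
      then show "e \<in> parcs H"
        using gE[of "?f (tail G a)" "?f (head G a)"] a by (simp add: gf f_in)
    next
      fix e assume e: "e \<in> parcs H"
      obtain i j where ij: "e = (i, j)"
        by (cases e)
      then have in_H: "i \<in> pverts H" "j \<in> pverts H"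
        using e H.in_arcsD1 H.in_arcsD2 by auto
      then have "g i \<rightarrow>\<^bsub>G\<^esub> g j"
        using gE e ij by blast
      then obtain a where "a \<in> arcs G" "tail G a = g i" "head G a = g j"
        by (auto simp: arcs_ends_conv)
      then show "e \<in> (\<lambda>a. (?f (tail G a), ?f (head G a))) ` arcs G"
        using ij in_H by (auto simp: image_iff the_inv_into_f_f[OF inj] intro!: bexI[of _ a])
    qed
    then show ?thesis
      using f by (simp add: app_iso_def with_proj_def hom_def bij_betw_def)
  qed
  ultimately show "digraph_iso G (with_proj H)"
    unfolding digraph_iso_def by blast
qed

section \<open>Lower bounds for the listed graphs\<close>

definition half_dominated :: "'c pair_pre_digraph \<Rightarrow> bool" where
  "half_dominated H \<longleftrightarrow> (\<forall>T. independent_set (with_proj H) T \<longrightarrow> dominating_set (with_proj H) T \<longrightarrow>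
    card (pverts H) \<le> 2 * card T)"

text \<open>The preimage of \<open>S\<close> under the bijection is independent and dominating in
  \<open>H\<close> and has the same size.\<close>

lemma (in subcubic_rel) half_dominated_copy:
  assumes "copy_of H V E" "half_dominated H" "indep_dom S"
  shows "card V \<le> 2 * card S"
proof -
  obtain g where g: "bij_betw g (pverts H) V"
    and gE: "\<And>i j. i \<in> pverts H \<Longrightarrow> j \<in> pverts H \<Longrightarrow> E (g i) (g j) \<longleftrightarrow> (i, j) \<in> parcs H"
    using assms(1) unfolding copy_of_def by blast
  define T where "T = {i \<in> pverts H. g i \<in> S}"
  have im: "g ` T = S"
    using g assms(3) by (auto simp: T_def bij_betw_def indep_dom_def)
  have "inj_on g T"
    using g by (auto simp: T_def bij_betw_def inj_on_def)
  then have "card T = card S"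
    using im card_image by fastforce
  moreover have "independent_set (with_proj H) T"
    using assms(3) by (auto simp: independent_set_def T_def indep_dom_def simp flip: gE)
  moreover have "dominating_set (with_proj H) T"
    unfolding dominating_set_def
  proof (intro conjI ballI)
    fix i assume "i \<in> verts (with_proj H) - T"
    then have i: "i \<in> pverts H" "g i \<notin> S" "g i \<in> V"
      using g by (auto simp: T_def bij_betw_def)
    then obtain s where "s \<in> S" "E (g i) s"
      using assms(3) unfolding indep_dom_def by blast
    then obtain j where "j \<in> T" "E (g i) (g j)"
      using im by blast
    then show "\<exists>j \<in> T. i \<rightarrow>\<^bsub>with_proj H\<^esub> j"
      using gE[of i j] i by (auto simp: T_def)
  qed (simp add: T_def)
  ultimately show ?thesis
    using assms(2) copy_of_card[OF assms(1)] by (auto simp: half_dominated_def)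
qed

text \<open>To dominate the leaf at \<open>v\<close>, the set must contain that leaf or
  \<open>v\<close> itself. Hence its projection to \<open>F\<close> is onto, and \<open>F\<close>
  has half of the vertices.\<close>

lemma half_dominated_cor:
  assumes "finite (pverts F)"
  shows "half_dominated (cor F)"
  unfolding half_dominated_def
proof (intro allI impI)
  fix T assume T: "independent_set (with_proj (cor F)) T" "dominating_set (with_proj (cor F)) T"
  have sub: "T \<subseteq> pverts F <+> pverts F"
    using T(1) by (simp add: independent_set_def pverts_cor)
  have "v \<in> case_sum id id ` T" if v: "v \<in> pverts F" for v
  proof (cases "Inr v \<in> T")
    case True
    then show ?thesis
      by force
  next
    case False
    then have "Inr v \<in> pverts (cor F) - T"
      using v by (auto simp: pverts_cor)
    then obtain t where "t \<in> T" "(Inr v, t) \<in> parcs (cor F)"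
      using T(2) unfolding dominating_set_def by auto
    then show ?thesis
      by (cases t) force+
  qed
  then have "card (pverts F) \<le> card T"
    using sub assms by (intro surj_card_le[of T _ "case_sum id id"]) (auto intro: finite_subset)
  then show "card (pverts (cor F)) \<le> 2 * card T"
    using assms by (simp add: pverts_cor card_Plus)
qed

text \<open>Membership in the set is passed as a predicate \<open>t\<close>, so that for a concrete
  graph the claim becomes propositional in finitely many atoms.\<close>

lemma half_dominatedI:
  assumes fin: "finite (pverts H)"
    and large: "\<forall>A \<in> \<A>. card (pverts H) \<le> 2 * card A"
    and contains: "\<And>t. \<forall>i \<in> pverts H. \<forall>j \<in> pverts H. t i \<and> t j \<longrightarrow> (i, j) \<notin> parcs H \<Longrightarrow>
      \<forall>i \<in> pverts H. t i \<or> (\<exists>j \<in> pverts H. t j \<and> (i, j) \<in> parcs H) \<Longrightarrow>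
      \<exists>A \<in> \<A>. \<forall>i \<in> A. t i"
  shows "half_dominated H"
  unfolding half_dominated_def
proof (intro allI impI)
  fix T assume T: "independent_set (with_proj H) T" "dominating_set (with_proj H) T"
  have sub: "T \<subseteq> pverts H"
    using T(1) by (simp add: independent_set_def)
  have "\<forall>i \<in> pverts H. \<forall>j \<in> pverts H. i \<in> T \<and> j \<in> T \<longrightarrow> (i, j) \<notin> parcs H"
    using T(1) by (auto simp: independent_set_def)
  moreover have "\<forall>i \<in> pverts H. i \<in> T \<or> (\<exists>j \<in> pverts H. j \<in> T \<and> (i, j) \<in> parcs H)"
    using T(2) sub by (auto simp: dominating_set_def)
  ultimately obtain A where A: "A \<in> \<A>" "A \<subseteq> T"
    using contains[of "\<lambda>i. i \<in> T"] by blast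
  then have "card A \<le> card T"
    using sub fin by (intro card_mono) (auto intro: finite_subset)
  then show "card (pverts H) \<le> 2 * card T"
    using A(1) large by fastforce
qed

lemma half_dominated_G1: "half_dominated G\<^sub>1"
proof (rule half_dominatedI[where \<A> = "{{0, 1}, {2, 3}}"])
  fix t
  assume *: "\<forall>i \<in> pverts G\<^sub>1. \<forall>j \<in> pverts G\<^sub>1. t i \<and> t j \<longrightarrow> (i, j) \<notin> parcs G\<^sub>1"
    "\<forall>i \<in> pverts G\<^sub>1. t i \<or> (\<exists>j \<in> pverts G\<^sub>1. t j \<and> (i, j) \<in> parcs G\<^sub>1)"
  have "t 0 \<and> t (Suc 0) \<or> t 2 \<and> t 3"
    using *[unfolded G1_simps lessThan_4_6 Un_iff mem_Sigma_iff, simplified] by argo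
  then show "\<exists>A \<in> {{0, 1}, {2, 3}}. \<forall>i \<in> A. t i"
    by simp
qed (simp_all add: G1_simps)

lemma half_dominated_G2: "half_dominated G\<^sub>2"
proof (rule half_dominatedI[where \<A> = "{{0, 1, 2}, {3, 4, 5}}"])
  fix t
  assume *: "\<forall>i \<in> pverts G\<^sub>2. \<forall>j \<in> pverts G\<^sub>2. t i \<and> t j \<longrightarrow> (i, j) \<notin> parcs G\<^sub>2"
    "\<forall>i \<in> pverts G\<^sub>2. t i \<or> (\<exists>j \<in> pverts G\<^sub>2. t j \<and> (i, j) \<in> parcs G\<^sub>2)"
  have "t 0 \<and> t (Suc 0) \<and> t 2 \<or> t 3 \<and> t 4 \<and> t 5"
    using *[unfolded G2_simps lessThan_4_6 Un_iff mem_Sigma_iff, simplified] by argo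
  then show "\<exists>A \<in> {{0, 1, 2}, {3, 4, 5}}. \<forall>i \<in> A. t i"
    by simp
qed (simp_all add: G2_simps)

text \<open>The family consists of all maximal independent sets: one contains 2, and the others
  contain the leaf 5 and one of {0, 1} and {3, 4}.\<close>

lemma half_dominated_G3: "half_dominated G\<^sub>3"
proof (rule half_dominatedI[where \<A> = "{{0, 1, 5}, {2, 3, 4}, {3, 4, 5}}"])
  fix t
  assume *: "\<forall>i \<in> pverts G\<^sub>3. \<forall>j \<in> pverts G\<^sub>3. t i \<and> t j \<longrightarrow> (i, j) \<notin> parcs G\<^sub>3"
    "\<forall>i \<in> pverts G\<^sub>3. t i \<or> (\<exists>j \<in> pverts G\<^sub>3. t j \<and> (i, j) \<in> parcs G\<^sub>3)"
  have "t 0 \<and> t (Suc 0) \<and> t 5 \<or> t 2 \<and> t 3 \<and> t 4 \<or> t 3 \<and> t 4 \<and> t 5"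
    using *[unfolded G3_simps lessThan_4_6 Un_iff mem_Sigma_iff, simplified] by argo
  then show "\<exists>A \<in> {{0, 1, 5}, {2, 3, 4}, {3, 4, 5}}. \<forall>i \<in> A. t i"
    by simp
qed (simp_all add: G3_simps)

text \<open>The maximal independent sets are {0, 4, 5}, {1, 2, 3} and {2, 3, 4, 5}; of the last,
  three vertices suffice.\<close>

lemma half_dominated_G4: "half_dominated G\<^sub>4"
proof (rule half_dominatedI[where \<A> = "{{0, 4, 5}, {1, 2, 3}, {2, 3, 4}}"])
  fix t
  assume *: "\<forall>i \<in> pverts G\<^sub>4. \<forall>j \<in> pverts G\<^sub>4. t i \<and> t j \<longrightarrow> (i, j) \<notin> parcs G\<^sub>4"
    "\<forall>i \<in> pverts G\<^sub>4. t i \<or> (\<exists>j \<in> pverts G\<^sub>4. t j \<and> (i, j) \<in> parcs G\<^sub>4)"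
  have "t 0 \<and> t 4 \<and> t 5 \<or> t (Suc 0) \<and> t 2 \<and> t 3 \<or> t 2 \<and> t 3 \<and> t 4"
    using *[unfolded G4_simps lessThan_4_6 Un_iff mem_Sigma_iff, simplified] by argo
  then show "\<exists>A \<in> {{0, 4, 5}, {1, 2, 3}, {2, 3, 4}}. \<forall>i \<in> A. t i"
    by simp
qed (simp_all add: G4_simps)

lemma half_dominated_G5: "half_dominated G\<^sub>5"
proof (rule half_dominatedI[where \<A> = "{{0, 2, 4}, {0, 2, 5}, {0, 3, 5}, {1, 3, 5}}"])
  fix t
  assume *: "\<forall>i \<in> pverts G\<^sub>5. \<forall>j \<in> pverts G\<^sub>5. t i \<and> t j \<longrightarrow> (i, j) \<notin> parcs G\<^sub>5"
    "\<forall>i \<in> pverts G\<^sub>5. t i \<or> (\<exists>j \<in> pverts G\<^sub>5. t j \<and> (i, j) \<in> parcs G\<^sub>5)"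
  have "t 0 \<and> t 2 \<and> t 4 \<or> t 0 \<and> t 2 \<and> t 5 \<or> t 0 \<and> t 3 \<and> t 5 \<or> t (Suc 0) \<and> t 3 \<and> t 5"
    using *[unfolded G5_simps lessThan_4_6 Un_iff mem_Sigma_iff, simplified] by argo
  then show "\<exists>A \<in> {{0, 2, 4}, {0, 2, 5}, {0, 3, 5}, {1, 3, 5}}. \<forall>i \<in> A. t i"
    by simp
qed (simp_all add: G5_simps)

lemma pair_graph_exceptional:
  assumes "H \<in> {G\<^sub>1, G\<^sub>2, G\<^sub>3, G\<^sub>4, G\<^sub>5}"
  shows "pair_graph H"
proof -
  have "pair_graph G\<^sub>1"
    by (rule pair_graphI) (auto simp: G1_simps sym_def)
  moreover have "pair_graph G\<^sub>2"
    by (rule pair_graphI) (auto simp: G2_simps sym_def)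
  moreover have "pair_graph G\<^sub>3"
    by (rule pair_graphI) (auto simp: G3_simps sym_def)
  moreover have "pair_graph G\<^sub>4"
    by (rule pair_graphI) (auto simp: G4_simps sym_def)
  moreover have "pair_graph G\<^sub>5"
    by (rule pair_graphI) (auto simp: G5_simps sym_def)
  ultimately show ?thesis
    using assms by blast
qed

text \<open>By symmetry of the arcs a connected graph is strongly connected, and membership in
  \<open>A\<close> spreads along directed reachability.\<close>

lemma (in graph) connected_closed_set:
  assumes "Digraph_Component.connected G" "A \<subseteq> verts G" "A \<noteq> {}"
    and closed: "\<And>x y. x \<in> A \<Longrightarrow> x \<rightarrow>\<^bsub>G\<^esub> y \<Longrightarrow> y \<in> A"
  shows "A = verts G"
proof
  show "verts G \<subseteq> A"
  proof
    fix v assume v: "v \<in> verts G"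
    obtain a where a: "a \<in> A"
      using assms(3) by blast
    have "strongly_connected G"
      using symmetric_connected_imp_strongly_connected sym_arcs assms(1) by blast
    then have "a \<rightarrow>\<^sup>*\<^bsub>G\<^esub> v"
      using a v assms(2) by (auto simp: strongly_connected_def)
    then show "v \<in> A"
      by (induct rule: reachable_induct) (use a closed in auto)
  qed
qed fact

theorem theorem5:
  fixes G :: "('a, 'b) pre_digraph" and n :: nat
  assumes "graph G"
    and "subcubic G"
    and "n = card (verts G)"
    and "\<not> (\<exists>v. isolated_vertex G v)"
  shows "real (indep_dom_number G) \<le> 1 / 2 * real n \<and>
    (Digraph_Component.connected G \<longrightarrow>
      (real (indep_dom_number G) = 1 / 2 * real n \<longleftrightarrow>
        (\<exists>H \<in> {G\<^sub>1, G\<^sub>2, G\<^sub>3, G\<^sub>4, G\<^sub>5}. digraph_iso G (with_proj H)) \<or>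
        (\<exists>k \<ge> 1. n = 2 * k \<and> digraph_iso G (with_proj (cor (path_graph k)))) \<or>
        (\<exists>k \<ge> 3. n = 2 * k \<and> digraph_iso G (with_proj (cor (cycle_graph k))))))"
proof -
  interpret graph G by fact
  let ?V = "verts G" and ?E = "\<lambda>u v. u \<rightarrow>\<^bsub>G\<^esub> v"
  have out_nbs: "{w. v \<rightarrow>\<^bsub>G\<^esub> w} = head G ` out_arcs G v" for v
    by (auto simp: arcs_ends_conv image_iff)
  interpret S: subcubic_rel ?V ?E
  proof
    show "card {w. v \<rightarrow>\<^bsub>G\<^esub> w} \<le> 3" for v
    proof (cases "v \<in> ?V")
      case True
      have "card {w. v \<rightarrow>\<^bsub>G\<^esub> w} \<le> out_degree G v"
        unfolding out_nbs out_degree_def by (rule card_image_le) (simp add: out_arcs_def)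
      then show ?thesis
        using assms(2) True by (force simp: subcubic_def)
    next
      case False
      then have "{w. v \<rightarrow>\<^bsub>G\<^esub> w} = {}"
        using adj_in_verts by blast
      then show ?thesis
        by simp
    qed
    show "\<not> v \<rightarrow>\<^bsub>G\<^esub> v" for v
      using adj_not_same by blast
    show "u \<rightarrow>\<^bsub>G\<^esub> v \<Longrightarrow> v \<rightarrow>\<^bsub>G\<^esub> u" for u v
      using sym_arcs by (auto simp: symmetric_def dest: symD)
  qed (auto dest: adj_in_verts)
  have no_isolated: "S.isolated = {}"
  proof -
    have "S.nbs v \<noteq> {}" if "v \<in> ?V" for v
    proof
      assume "S.nbs v = {}"
      then have "out_degree G v = 0"
        using out_nbs[of v] by (simp add: S.nbs_def out_degree_def)
      then show False
        using assms(4) that by (auto simp: isolated_vertex_def)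
    qed
    then show ?thesis
      by (auto simp: S.isolated_def)
  qed
  have indep_dom: "S.indep_dom T \<longleftrightarrow> independent_set G T \<and> dominating_set G T" for T
    by (auto simp: S.indep_dom_def independent_set_def dominating_set_def)
  obtain T\<^sub>0 where T\<^sub>0: "S.indep_dom T\<^sub>0" "card T\<^sub>0 = indep_dom_number G"
    using LeastI_ex[of "\<lambda>k. \<exists>S. independent_set G S \<and> dominating_set G S \<and> card S = k"]
      indep_dom_set_exists unfolding indep_dom indep_dom_number_def by blast
  have least: "indep_dom_number G \<le> card T" if "S.indep_dom T" for T
    using that unfolding indep_dom indep_dom_number_def by (intro Least_le) blast
  obtain T\<^sub>1 where "S.indep_dom T\<^sub>1" "2 * card T\<^sub>1 \<le> card ?V"
    using indep_dom_bound[OF S.subcubic_rel_axioms] no_isolated by auto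
  then have bound: "2 * indep_dom_number G \<le> n"
    using least[of T\<^sub>1] assms(3) by simp
  have pair_graphs: "pair_graph (cor (path_graph k))" "k \<ge> 3 \<Longrightarrow> pair_graph (cor (cycle_graph k))" for k
    using pair_graph_cor pair_graph_path_graph pair_graph_cycle_graph by blast+
  have "2 * indep_dom_number G = n \<longleftrightarrow>
        (\<exists>H \<in> {G\<^sub>1, G\<^sub>2, G\<^sub>3, G\<^sub>4, G\<^sub>5}. digraph_iso G (with_proj H)) \<or>
        (\<exists>k \<ge> 1. n = 2 * k \<and> digraph_iso G (with_proj (cor (path_graph k)))) \<or>
        (\<exists>k \<ge> 3. n = 2 * k \<and> digraph_iso G (with_proj (cor (cycle_graph k))))" (is "?L \<longleftrightarrow> ?R")
    if conn: "Digraph_Component.connected G"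
  proof
    assume ?L
    \<comment> \<open>Since the minimum is n/2, every independent dominating set has at least n/2
      vertices, as \<open>extremal_subtwins\<close> requires.\<close>
    then have extremal: "card ?V \<le> 2 * card T" if "S.indep_dom T" for T
      using least[OF that] assms(3) by simp
    interpret tight_graph ?V ?E
    proof
      show "S.nbs v \<noteq> {}" if "v \<in> ?V" for v
        using no_isolated that by (auto simp: S.isolated_def)
      show "card (S.nbs v) \<le> card (S.subtwins v) + 1" if "v \<in> ?V" for v
        using S.extremal_subtwins[OF no_isolated extremal that] .
      \<comment> \<open>Connectedness as defined includes that there is a vertex.\<close>
      show "?V \<noteq> {}"
        using conn by (auto simp: Digraph_Component.connected_def strongly_connected_def)
      show "A = ?V" if "A \<subseteq> ?V" "A \<noteq> {}" "\<And>x. x \<in> A \<Longrightarrow> S.nbs x \<subseteq> A" for A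
        using connected_closed_set[OF conn that(1,2)] that(3) by (auto simp: S.nbs_def)
    qed
    have cards: "n = 2 * k"
      if "copy_of (cor (path_graph k)) ?V ?E \<or> copy_of (cor (cycle_graph k)) ?V ?E" for k
      using that copy_of_card assms(3) by (fastforce simp: pverts_cor card_Plus)
    show ?R
      using tight_graph_classification cards pair_graphs pair_graph_exceptional digraph_iso_iff_copy_of by metis
  next
    assume ?R
    moreover have "half_dominated H" if "H \<in> {G\<^sub>1, G\<^sub>2, G\<^sub>3, G\<^sub>4, G\<^sub>5}" for H
      using that half_dominated_G1 half_dominated_G2 half_dominated_G3 half_dominated_G4
        half_dominated_G5 by blast
    moreover have "half_dominated (cor (path_graph k))" "half_dominated (cor (cycle_graph k))" for k
      by (simp_all add: half_dominated_cor)
    \<comment> \<open>\<open>T\<^sub>0\<close> attains the minimum, so the lower bound for the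
      listed graph meets the general upper bound.\<close>
    ultimately have "card ?V \<le> 2 * card T\<^sub>0"
      using S.half_dominated_copy[OF _ _ T\<^sub>0(1)] pair_graphs pair_graph_exceptional digraph_iso_iff_copy_of
      by metis
    then show ?L
      using bound assms(3) T\<^sub>0(2) by simp
  qed
  moreover have "real (indep_dom_number G) = 1 / 2 * real n \<longleftrightarrow> 2 * indep_dom_number G = n"
    by linarith
  moreover have "real (indep_dom_number G) \<le> 1 / 2 * real n"
    using bound by linarith
  ultimately show ?thesis
    by blast
qed

end
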